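(* Let $n\ge 1$, let $\alpha,\beta>0$ and $q_0,q_1\in[1,+\infty]$ with $q_0\ne q_1$. Let $\theta=\frac{\alpha}{\alpha+\beta}\in(0,1)$ and let $p$ be defined by $\frac1p=\frac{1-\theta}{q_0}+\frac{\theta}{q_1}$. Assume $p\le 2$, and let $$I=\Big\{(x,y)\in[0,1]^2 : (1-\theta)x+\theta y=\tfrac1p\Big\}=[(x_0,y_0),(x_1,y_1)]$$ be the line segment with endpoints $(x_0,y_0)$ and $(x_1,y_1)$, labelled so that $x_0<y_0$ and $y_1<x_1$. If $r_0,r_1\in[1,+\infty]$ satisfy $$x_0\le\frac1{r_0}\le\frac1{r_1}\le y_0\qquad\text{or}\qquad y_1\le\frac1{r_1}\le\frac1{r_0}\le x_1,$$ and if $\frac1r=\frac{1-\theta}{r_0}+\frac{\theta}{r_1}$, then there is a constant $C_0$ such that every $f\in\dot B^{\alpha,q_0}_{r_0}\cap\dot B^{-\beta,q_1}_{r_1}(\mathbb{R}^n)$ belongs to $L^{p,r}(\mathbb{R}^n)$ and satisfies $$\|f\|_{L^{p,r}}\le C_0\,\|f\|_{\dot B^{\alpha,q_0}_{r_0}}^{1-\theta}\,\|f\|_{\dot B^{-\beta,q_1}_{r_1}}^{\theta}.$$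
   Context: Littlewood–Paley decomposition: fix a nonnegative $\varphi\in C_c^\infty(\mathbb{R}^n)$ with $\varphi(\xi)=1$ for $|\xi|\le 1/2$ and $\varphi(\xi)=0$ for $|\xi|\ge 1$, and put $\psi(\xi)=\varphi(\xi/2)-\varphi(\xi)$. For $f\in\mathcal{S}'(\mathbb{R}^n)$ and $j\in\mathbb{Z}$, the dyadic block $\Delta_jf$ is defined by $\widehat{\Delta_jf}(\xi)=\psi(2^{-j}\xi)\widehat f(\xi)$. For $s\in\mathbb{R}$ and $q,r\in[1,+\infty]$, the semi-norm of the homogeneous Besov space $\dot B^{s,q}_r(\mathbb{R}^n)$ (first upper index: regularity; second upper index: Lebesgue exponent; lower index: summation exponent) is $\|f\|_{\dot B^{s,q}_r}=\big(\sum_{j\in\mathbb{Z}}2^{jsr}\|\Delta_jf\|_{L^q}^r\big)^{1/r}$, with the supremum over $j$ when $r=+\infty$. Convention: for $\alpha,\beta>0$, $f\in\dot B^{\alpha,q_0}_{r_0}\cap\dot B^{-\beta,q_1}_{r_1}$ means that $f\in\mathcal{S}'(\mathbb{R}^n)$ satisfies $f=\sum_{j\in\mathbb{Z}}\Delta_jf$ (convergence in $\mathcal{S}'$) and that both semi-norms are finite. Lorentz spaces: for $1<p<+\infty$, $1\le r\le+\infty$, $L^{p,r}(\mathbb{R}^n)$ is the set of measurable $f$ (modulo a.e. equality) with $\|f\|_{L^{p,r}}=\big(\int_0^{+\infty}(s^{1/p}f^*(s))^r\frac{ds}{s}\big)^{1/r}<+\infty$ (and $\sup_{s>0}s^{1/p}f^*(s)$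 when $r=+\infty$), where $d_f(t)$ is the Lebesgue measure of $\{x:|f(x)|\ge t\}$ and $f^*(s)=\inf\{t:d_f(t)\le s\}$; equivalently, up to equivalence of norms, $L^{p,r}$ is the real interpolation space $[L^1,L^\infty]_{1-1/p,r}$. Note that $q_0\ne q_1$ forces $1<p<+\infty$. *)

theory Defs
  imports "HOL-Analysis.Analysis" "HOL-Probability.Essential_Supremum"
begin

definition recip :: "ennreal \<Rightarrow> real" where
  "recip q = enn2real (inverse q)"

(* Only used for exponents a > 0. *)
definition epow :: "ennreal \<Rightarrow> real \<Rightarrow> ennreal" (infixr "^\<^sub>e" 80) where
  "x ^\<^sub>e a = (if x = \<infinity> then \<infinity> else ennreal (enn2real x powr a))"


section \<open>Schwartz functions and tempered distributions\<close>

fun iter_pderiv :: "'n list \<Rightarrow> (real^'n \<Rightarrow> 'b::real_normed_vector) \<Rightarrow> real^'n \<Rightarrow> 'b" where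
  "iter_pderiv [] f = f"
| "iter_pderiv (i # is) f =
     (\<lambda>x. frechet_derivative (iter_pderiv is f) (at x) (axis i 1))"

definition smooth :: "(real^'n \<Rightarrow> 'b::real_normed_vector) \<Rightarrow> bool" where
  "smooth f \<longleftrightarrow> (\<forall>is x. iter_pderiv is f differentiable (at x))"

definition schwartz_space :: "(real^'n \<Rightarrow> complex) set" where
  "schwartz_space = {f. smooth f \<and>
     (\<forall>k is. bounded (range (\<lambda>x. (1 + norm x) ^ k *\<^sub>R iter_pderiv is f x)))}"

definition schwartz_seminorm :: "nat \<Rightarrow> 'n list \<Rightarrow> (real^'n \<Rightarrow> complex) \<Rightarrow> real" where
  "schwartz_seminorm k is f = (SUP x. (1 + norm x) ^ k * norm (iter_pderiv is f x))"

(* Distributions are rendered as functionals on all functions; only their values on the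
   Schwartz space are ever used. *)
type_synonym 'n functional = "(real^'n \<Rightarrow> complex) \<Rightarrow> complex"

definition tempered :: "('n::finite) functional \<Rightarrow> bool" where
  "tempered u \<longleftrightarrow>
     (\<forall>f\<in>schwartz_space. \<forall>g\<in>schwartz_space. u (\<lambda>x. f x + g x) = u f + u g) \<and>
     (\<forall>c. \<forall>f\<in>schwartz_space. u (\<lambda>x. c * f x) = c * u f) \<and>
     (\<exists>C N. \<forall>f\<in>schwartz_space.
        norm (u f) \<le> C * (\<Sum>is | length is \<le> N. schwartz_seminorm N is f))"

definition represents :: "(real^'n \<Rightarrow> complex) \<Rightarrow> ('n::finite) functional \<Rightarrow> bool" where
  "represents g u \<longleftrightarrow> g \<in> borel_measurable lebesgue \<and>
     (\<forall>f\<in>schwartz_space. integrable lebesgue (\<lambda>x. g x * f x) \<and>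
        u f = (LINT x|lebesgue. g x * f x))"


section \<open>Fourier transform\<close>

definition fourier :: "(real^'n \<Rightarrow> complex) \<Rightarrow> real^'n \<Rightarrow> complex" where
  "fourier f = (\<lambda>\<xi>. LINT x|lebesgue. f x * cis (- (x \<bullet> \<xi>)))"

definition inv_fourier :: "(real^'n \<Rightarrow> complex) \<Rightarrow> real^'n \<Rightarrow> complex" where
  "inv_fourier f =
     (\<lambda>x. (LINT \<xi>|lebesgue. f \<xi> * cis (x \<bullet> \<xi>)) / of_real ((2 * pi) ^ CARD('n)))"

(* On tempered distributions all operations are defined by transposition. *)
definition dfourier :: "('n::finite) functional \<Rightarrow> 'n functional" where
  "dfourier u = (\<lambda>f. u (fourier f))"

definition inv_dfourier :: "('n::finite) functional \<Rightarrow> 'n functional" where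
  "inv_dfourier u = (\<lambda>f. u (inv_fourier f))"

definition dmult :: "(real^'n \<Rightarrow> real) \<Rightarrow> ('n::finite) functional \<Rightarrow> 'n functional" where
  "dmult m u = (\<lambda>f. u (\<lambda>\<xi>. of_real (m \<xi>) * f \<xi>))"


section \<open>Littlewood--Paley decomposition and Besov semi-norms\<close>

(* Compactness of the support follows from the last condition. *)
definition lp_cutoff :: "(real^'n \<Rightarrow> real) \<Rightarrow> bool" where
  "lp_cutoff \<phi> \<longleftrightarrow> smooth \<phi> \<and> (\<forall>\<xi>. 0 \<le> \<phi> \<xi>) \<and>
     (\<forall>\<xi>. norm \<xi> \<le> 1/2 \<longrightarrow> \<phi> \<xi> = 1) \<and> (\<forall>\<xi>. norm \<xi> \<ge> 1 \<longrightarrow> \<phi> \<xi> = 0)"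

definition lp_psi :: "(real^'n \<Rightarrow> real) \<Rightarrow> real^'n \<Rightarrow> real" where
  "lp_psi \<phi> \<xi> = \<phi> ((1/2) *\<^sub>R \<xi>) - \<phi> \<xi>"

definition lp_block :: "(real^'n \<Rightarrow> real) \<Rightarrow> int \<Rightarrow> ('n::finite) functional \<Rightarrow> 'n functional" where
  "lp_block \<phi> j u =
     inv_dfourier (dmult (\<lambda>\<xi>. lp_psi \<phi> ((2 powr (- real_of_int j)) *\<^sub>R \<xi>)) (dfourier u))"

definition Lq_norm :: "ennreal \<Rightarrow> (real^'n \<Rightarrow> complex) \<Rightarrow> ennreal" where
  "Lq_norm q g =
     (if q = \<infinity> then esssup lebesgue (\<lambda>x. ennreal (norm (g x)))
      else (\<integral>\<^sup>+x. ennreal (norm (g x)) ^\<^sub>e enn2real q \<partial>lebesgue) ^\<^sub>e (1 / enn2real q))"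

(* A representing function is unique up to a.e. equality, so this is an infimum over at most
   one value; it is infinite if the distribution is not given by a function. *)
definition dLq_norm :: "ennreal \<Rightarrow> ('n::finite) functional \<Rightarrow> ennreal" where
  "dLq_norm q u = Inf {Lq_norm q g | g. represents g u}"

definition besov_seminorm ::
  "(real^'n \<Rightarrow> real) \<Rightarrow> real \<Rightarrow> ennreal \<Rightarrow> ennreal \<Rightarrow> ('n::finite) functional \<Rightarrow> ennreal" where
  "besov_seminorm \<phi> s q r u =
     (if r = \<infinity> then (SUP j. ennreal (2 powr (real_of_int j * s)) * dLq_norm q (lp_block \<phi> j u))
      else (\<Sum>\<^sub>\<infinity>j. ennreal (2 powr (real_of_int j * s * enn2real r)) *
              dLq_norm q (lp_block \<phi> j u) ^\<^sub>e enn2real r) ^\<^sub>e (1 / enn2real r))"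

definition besov_inter ::
  "(real^'n \<Rightarrow> real) \<Rightarrow> real \<Rightarrow> ennreal \<Rightarrow> ennreal \<Rightarrow> real \<Rightarrow> ennreal \<Rightarrow> ennreal
    \<Rightarrow> ('n::finite) functional set" where
  "besov_inter \<phi> s\<^sub>0 q\<^sub>0 r\<^sub>0 s\<^sub>1 q\<^sub>1 r\<^sub>1 = {u. tempered u \<and>
     (\<forall>f\<in>schwartz_space.
        ((\<lambda>(M, N). \<Sum>j = - int M..int N. lp_block \<phi> j u f) \<longlongrightarrow> u f)
          (sequentially \<times>\<^sub>F sequentially)) \<and>
     besov_seminorm \<phi> s\<^sub>0 q\<^sub>0 r\<^sub>0 u < \<infinity> \<and> besov_seminorm \<phi> s\<^sub>1 q\<^sub>1 r\<^sub>1 u < \<infinity>}"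


section \<open>Lorentz spaces\<close>

definition distribution_fun :: "(real^'n \<Rightarrow> complex) \<Rightarrow> real \<Rightarrow> ennreal" where
  "distribution_fun g t = emeasure lebesgue {x. norm (g x) \<ge> t}"

(* Levels t \<le> 0 never qualify, since their distribution function is infinite. *)
definition rearrangement :: "(real^'n \<Rightarrow> complex) \<Rightarrow> real \<Rightarrow> ennreal" where
  "rearrangement g s = Inf (ennreal ` {t. distribution_fun g t \<le> ennreal s})"

definition lorentz_norm :: "real \<Rightarrow> ennreal \<Rightarrow> (real^'n \<Rightarrow> complex) \<Rightarrow> ennreal" where
  "lorentz_norm p r g =
     (if r = \<infinity> then (SUP s\<in>{0<..}. ennreal (s powr (1/p)) * rearrangement g s)
      else (\<integral>\<^sup>+s\<in>{0<..}. (ennreal (s powr (1/p)) * rearrangement g s) ^\<^sub>e enn2real r / ennreal s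
              \<partial>lborel) ^\<^sub>e (1 / enn2real r))"

definition lorentz_space :: "real \<Rightarrow> ennreal \<Rightarrow> (real^'n \<Rightarrow> complex) set" where
  "lorentz_space p r = {g \<in> borel_measurable lebesgue. lorentz_norm p r g < \<infinity>}"

end

theory Submission
  imports Defs
begin

text \<open>Let \<open>g\<^sub>j\<close> be the dyadic blocks of \<open>f\<close>, \<open>d\<^sub>j\<close> and \<open>d'\<^sub>j\<close> their \<open>L\<^sup>q\<close>-norms for \<open>q = q\<^sub>0\<close> and \<open>q = q\<^sub>1\<close>, and
  \<open>c\<^sub>j(s) = min (d\<^sub>j s powr (-1/q\<^sub>0)) (d'\<^sub>j s powr (-1/q\<^sub>1))\<close>. The part of \<open>\<bar>g\<^sub>j\<bar>\<close> above the level \<open>c\<^sub>j(s)\<close> has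
  integral at most \<open>c\<^sub>j(s) s\<close>, so by Markov's inequality the rearrangement of \<open>\<Sum>\<^sub>j \<bar>g\<^sub>j\<bar>\<close> at \<open>s\<close> is at most
  \<open>2 \<Sum>\<^sub>j c\<^sub>j(s)\<close>. With \<open>a\<^sub>j = 2 powr (j\<alpha>) d\<^sub>j\<close>, \<open>b\<^sub>j = 2 powr (-j\<beta>) d'\<^sub>j\<close> and \<open>s = 2 powr k\<close>, the number
  \<open>s powr (1/p) c\<^sub>j(s)\<close> is the minimum of \<open>2 powr (\<alpha>D) a\<^sub>j\<close> and \<open>2 powr (-\<beta>D) b\<^sub>j\<close>, where \<open>D = \<kappa>k - j\<close> and
  \<open>\<kappa> = (1/q\<^sub>1 - 1/q\<^sub>0)/(\<alpha>+\<beta>) \<noteq> 0\<close>. This minimum decays exponentially on both sides of the value of \<open>D\<close> where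
  the two terms agree. Hence its sum over \<open>j\<close> is at most a constant times \<open>A\<^sub>k powr (1-\<theta>) B\<^sub>k powr \<theta>\<close> for
  sequences \<open>A\<close>, \<open>B\<close> bounded in the spaces of \<open>a\<close>, \<open>b\<close>, and Hoelder's inequality in \<open>k\<close> concludes.\<close>

section \<open>Reciprocals of exponents in [1, \<infinity>]\<close>

lemma recip_eq: "r \<noteq> \<infinity> \<Longrightarrow> r \<ge> 1 \<Longrightarrow> recip r = 1 / enn2real r"
  unfolding recip_def
  by (cases r) (auto simp: inverse_ennreal inverse_eq_divide ennreal_le_iff ennreal_1[symmetric] simp del: ennreal_1)

lemma recip_top [simp]: "recip \<infinity> = 0" "recip top = 0"
  by (auto simp: recip_def)

lemma enn2real_ge_1: "r \<noteq> \<infinity> \<Longrightarrow> r \<ge> 1 \<Longrightarrow> enn2real r \<ge> 1"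
  by (cases r) (auto simp: ennreal_1[symmetric] simp del: ennreal_1)

lemma recip_bounds: "r \<ge> 1 \<Longrightarrow> 0 \<le> recip r \<and> recip r \<le> 1"
  using recip_eq[of r] enn2real_ge_1[of r] by (cases "r = \<infinity>") auto

lemma recip_eq_0_iff: "r \<ge> 1 \<Longrightarrow> recip r = 0 \<longleftrightarrow> r = \<infinity>"
  using recip_eq[of r] enn2real_ge_1[of r] by (cases "r = \<infinity>") (auto simp: field_simps)

section \<open>The inequality for sequences\<close>

lemma sum_power_inj_le:
  fixes q :: real
  assumes "0 \<le> q" "q < 1" "finite F" "inj_on f F"
  shows "(\<Sum>j\<in>F. q ^ f j) \<le> 1 / (1 - q)"
proof -
  have "(\<Sum>j\<in>F. q ^ f j) = (\<Sum>i\<in>f ` F. q ^ i)"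
    using assms(4) by (simp add: sum.reindex)
  also have "\<dots> \<le> (\<Sum>i. q ^ i)"
    using assms by (intro sum_le_suminf) (auto intro: summable_geometric)
  also have "\<dots> = 1 / (1 - q)"
    using assms by (intro suminf_geometric) auto
  finally show ?thesis .
qed

text \<open>Replacing t by its floor m changes distances by at most 1, which costs a factor 2 powr
  c. What remains is a geometric series on each side of m, so the bound depends neither on t nor on
  F.\<close>

lemma sum_exp_decay_le:
  fixes c :: real
  assumes "c > 0"
  shows "\<exists>C\<ge>1. \<forall>t F. finite F \<longrightarrow> (\<Sum>j\<in>F. 2 powr (- (c * \<bar>t - real_of_int j\<bar>))) \<le> C"
proof -
  define q where "q = 2 powr (- c)"
  have q: "0 < q" "q < 1"
    using assms by (auto simp: q_def powr_less_one)
  have le: "(\<Sum>j\<in>F. 2 powr (- (c * \<bar>t - real_of_int j\<bar>))) \<le> 2 powr c * (2 / (1 - q))"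
    if F: "finite F" for t F
  proof -
    define m where "m = \<lfloor>t\<rfloor>"
    have pt: "2 powr (- (c * \<bar>t - real_of_int j\<bar>)) \<le> 2 powr c * q ^ nat \<bar>m - j\<bar>" for j
    proof -
      have "\<bar>t - real_of_int j\<bar> \<ge> real_of_int \<bar>m - j\<bar> - 1"
        unfolding m_def by linarith
      then have "c * \<bar>t - real_of_int j\<bar> \<ge> c * (real_of_int \<bar>m - j\<bar> - 1)"
        using assms by (intro mult_left_mono) auto
      then have "2 powr (- (c * \<bar>t - real_of_int j\<bar>)) \<le> 2 powr (c + (- c) * real (nat \<bar>m - j\<bar>))"
        by (intro powr_mono) (auto simp: algebra_simps)
      also have "\<dots> = 2 powr c * q ^ nat \<bar>m - j\<bar>"
        unfolding powr_add q_def by (simp only: powr_powr[symmetric] powr_realpow powr_gt_zero)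
      finally show ?thesis .
    qed
    \<comment> \<open>On either side of m the exponent |m - j| is injective in j.\<close>
    have "(\<Sum>j\<in>F. q ^ nat \<bar>m - j\<bar>) =
        (\<Sum>j\<in>{j\<in>F. j \<le> m}. q ^ nat \<bar>m - j\<bar>) + (\<Sum>j\<in>{j\<in>F. \<not> j \<le> m}. q ^ nat \<bar>m - j\<bar>)"
      using F by (subst sum.union_disjoint[symmetric]) (auto intro!: sum.cong)
    also have "\<dots> \<le> 1 / (1 - q) + 1 / (1 - q)"
      using F q by (intro add_mono sum_power_inj_le) (auto simp: inj_on_def)
    finally have "(\<Sum>j\<in>F. q ^ nat \<bar>m - j\<bar>) \<le> 2 / (1 - q)" by simp
    then have "2 powr c * (\<Sum>j\<in>F. q ^ nat \<bar>m - j\<bar>) \<le> 2 powr c * (2 / (1 - q))"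
      by (intro mult_left_mono) auto
    moreover have "(\<Sum>j\<in>F. 2 powr (- (c * \<bar>t - real_of_int j\<bar>))) \<le> 2 powr c * (\<Sum>j\<in>F. q ^ nat \<bar>m - j\<bar>)"
      unfolding sum_distrib_left by (intro sum_mono pt)
    ultimately show ?thesis by linarith
  qed
  show ?thesis
    by (rule exI[of _ "max 1 (2 powr c * (2 / (1 - q)))"]) (use le in \<open>auto intro: max.coboundedI2\<close>)
qed

text \<open>The minimum of \<open>X = 2 powr (\<alpha>D) a\<close> and \<open>Y = 2 powr (-\<beta>D) b\<close> is at most \<open>w X powr (1-\<eta>) Y powr \<eta>\<close> for
  all \<open>\<eta>\<close> between \<open>\<epsilon>\<close> and \<open>1-\<epsilon>\<close>; playing \<open>\<eta> = \<theta> + \<epsilon>\<close> against \<open>\<eta> = \<theta> - \<epsilon>\<close> gives decay in \<open>D\<close>.\<close>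
lemma min_powr_le:
  fixes \<alpha> \<beta> \<theta> \<epsilon> a b A B D :: real
  defines "w \<equiv> 2 powr (- (\<epsilon> * \<bar>(\<alpha> + \<beta>) * D + log 2 a - log 2 b\<bar>))"
  assumes pos: "a > 0" "b > 0" "A > 0" "B > 0"
    and \<theta>: "\<alpha> = \<theta> * (\<alpha> + \<beta>)" and \<epsilon>: "0 < \<epsilon>" "2 * \<epsilon> \<le> \<theta>" "2 * \<epsilon> \<le> 1 - \<theta>"
    and le: "a * w \<le> A" "b * w \<le> B"
  shows "min (2 powr (\<alpha> * D) * a) (2 powr (- \<beta> * D) * b)
    \<le> A powr (1 - \<theta>) * B powr \<theta> * 2 powr (- (\<epsilon> * \<bar>(\<alpha> + \<beta>) * D + log 2 A - log 2 B\<bar>))"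
proof -
  \<comment> \<open>In base 2 logarithms the claim is linear: the hypotheses on w say that
    \<open>la\<close> and \<open>lb\<close>, lowered by \<epsilon> |d|, are at most
    \<open>LA\<close> and \<open>LB\<close>.\<close>
  define la lb LA LB where "la = log 2 a" "lb = log 2 b" "LA = log 2 A" "LB = log 2 B"
  note l = this
  have ab: "a = 2 powr la" "b = 2 powr lb" "A = 2 powr LA" "B = 2 powr LB"
    using pos by (auto simp: l)
  define X Y where "X = \<alpha> * D + la" "Y = - \<beta> * D + lb"
  define d where "d = (\<alpha> + \<beta>) * D + la - lb"
  have XY: "X - Y = d" by (simp add: X_Y_def d_def algebra_simps)
  have w: "w = 2 powr (- (\<epsilon> * \<bar>d\<bar>))" by (simp add: w_def d_def l)
  have leA: "la - \<epsilon> * \<bar>d\<bar> \<le> LA"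
    using le(1) by (simp add: ab w flip: powr_add)
  have leB: "lb - \<epsilon> * \<bar>d\<bar> \<le> LB"
    using le(2) by (simp add: ab w flip: powr_add)
  have key: "min X Y \<le> (1 - \<theta>) * LA + \<theta> * LB + (\<theta> - \<eta>) * ((\<alpha> + \<beta>) * D + LA - LB)"
    if \<eta>: "\<epsilon> \<le> \<eta>" "\<epsilon> \<le> 1 - \<eta>" for \<eta>
  proof -
    \<comment> \<open>Both weights are at least \<epsilon>, so the convex combination exceeds the
      minimum by at least \<epsilon> |X - Y|. This surplus pays for the factor w in the
      hypotheses.\<close>
    have "min X Y \<le> (1 - \<eta>) * X + \<eta> * Y - \<epsilon> * \<bar>X - Y\<bar>"
    proof (cases "X \<le> Y")
      case True
      have "\<epsilon> * (Y - X) \<le> \<eta> * (Y - X)" using True \<eta> by (intro mult_right_mono) auto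
      with True show ?thesis by (simp add: algebra_simps)
    next
      case False
      have "\<epsilon> * (X - Y) \<le> (1 - \<eta>) * (X - Y)" using False \<eta> by (intro mult_right_mono) auto
      with False show ?thesis by (simp add: algebra_simps)
    qed
    also have "\<dots> = (\<alpha> - \<eta> * (\<alpha> + \<beta>)) * D + (1 - \<eta>) * (la - \<epsilon> * \<bar>d\<bar>) + \<eta> * (lb - \<epsilon> * \<bar>d\<bar>)"
      unfolding XY by (simp add: X_Y_def algebra_simps)
    also have "\<alpha> - \<eta> * (\<alpha> + \<beta>) = (\<theta> - \<eta>) * (\<alpha> + \<beta>)"
      by (subst \<theta>) (simp add: algebra_simps)
    also have "(\<theta> - \<eta>) * (\<alpha> + \<beta>) * D + (1 - \<eta>) * (la - \<epsilon> * \<bar>d\<bar>) + \<eta> * (lb - \<epsilon> * \<bar>d\<bar>)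
       \<le> (\<theta> - \<eta>) * (\<alpha> + \<beta>) * D + (1 - \<eta>) * LA + \<eta> * LB"
      using \<eta> \<epsilon> leA leB by (intro add_mono mult_left_mono order_refl) auto
    finally show ?thesis by (simp add: algebra_simps)
  qed
  \<comment> \<open>For \<eta> = \<theta> + \<epsilon> and \<eta> = \<theta> - \<epsilon> both
    \<eta> and 1 - \<eta> stay at least \<epsilon>; this is where the factor 2 in the conditions on
    \<epsilon> enters.\<close>
  have "min X Y \<le> (1 - \<theta>) * LA + \<theta> * LB - \<epsilon> * \<bar>(\<alpha> + \<beta>) * D + LA - LB\<bar>"
  proof (cases "(\<alpha> + \<beta>) * D + LA - LB \<ge> 0")
    case True
    then show ?thesis using key[of "\<theta> + \<epsilon>"] \<epsilon> by (simp add: algebra_simps)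
  next
    case False
    then show ?thesis using key[of "\<theta> - \<epsilon>"] \<epsilon> by (simp add: algebra_simps)
  qed
  then have "2 powr min X Y \<le> 2 powr ((1 - \<theta>) * LA + \<theta> * LB - \<epsilon> * \<bar>(\<alpha> + \<beta>) * D + LA - LB\<bar>)"
    by simp
  moreover have "2 powr min X Y = min (2 powr X) (2 powr Y)" by (auto simp: min_def)
  ultimately show ?thesis
    by (simp add: ab X_Y_def powr_add powr_diff powr_minus powr_powr field_simps)
qed

text \<open>An upper bound for the norm in the sequence space l^r, meant for nonnegative a and N.
  Finite sums of r-th powers avoid summability conditions and the r-th root.\<close>

definition seq_norm_le :: "ennreal \<Rightarrow> (int \<Rightarrow> real) \<Rightarrow> real \<Rightarrow> bool" where
  "seq_norm_le r a N \<longleftrightarrow> (if r = \<infinity> then \<forall>j. a j \<le> N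
     else \<forall>F. finite F \<longrightarrow> (\<Sum>j\<in>F. a j powr enn2real r) \<le> N powr enn2real r)"

lemma seq_norm_le_pointwise:
  assumes "seq_norm_le r a N" "r \<ge> 1" "0 \<le> a j" "0 \<le> N"
  shows "a j \<le> N"
proof (cases "r = \<infinity>")
  case False
  then have "\<forall>F. finite F \<longrightarrow> (\<Sum>j\<in>F. a j powr enn2real r) \<le> N powr enn2real r"
    using assms(1) by (simp add: seq_norm_le_def)
  from spec[OF this, of "{j}"] have "a j powr enn2real r \<le> N powr enn2real r"
    by simp
  then show ?thesis
    using enn2real_ge_1[OF False assms(2)] assms(3,4)
    by (metis less_le_trans not_le powr_less_mono2 zero_less_one)
qed (use assms in \<open>auto simp: seq_norm_le_def\<close>)

lemma seq_norm_le_scale: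
  assumes "seq_norm_le r a N" "0 \<le> c" "\<And>j. 0 \<le> a j" "0 \<le> N"
  shows "seq_norm_le r (\<lambda>j. c * a j) (c * N)"
  using assms by (auto simp: seq_norm_le_def powr_mult mult_left_mono simp flip: sum_distrib_left)

text \<open>For each k an index \<open>f k\<close> attains the supremum up to a factor 2. Grouping
  the k by the value of \<open>f k\<close>, the group of j contributes at most the r-th power of a j
  times the sum of the weights w j k over k.\<close>

lemma seq_norm_le_weighted_sup:
  fixes a :: "int \<Rightarrow> real" and w :: "int \<Rightarrow> int \<Rightarrow> real"
  assumes a: "seq_norm_le r a N" "r \<ge> 1" "0 \<le> N" "\<And>j. 0 \<le> a j"
    and w: "\<And>j k. 0 \<le> w j k" "\<And>j k. w j k \<le> 1"
    and C: "1 \<le> C" "\<And>j F. finite F \<Longrightarrow> (\<Sum>k\<in>F. w j k) \<le> C"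
  shows "\<And>j k. a j * w j k \<le> (SUP j. a j * w j k)"
    and "seq_norm_le r (\<lambda>k. SUP j. a j * w j k) (2 * C * N)"
proof -
  have le_N: "a j * w j k \<le> N" for j k
    using mult_mono[OF seq_norm_le_pointwise[OF a(1,2) a(4) a(3), of j] w(2)[of j k]] a(3) w(1)[of j k]
    by simp
  then have bdd: "bdd_above (range (\<lambda>j. a j * w j k))" for k
    by (intro bdd_aboveI2) auto
  show ub: "a j * w j k \<le> (SUP j. a j * w j k)" for j k
    by (rule cSUP_upper[OF _ bdd]) auto
  define A where "A k = (SUP j. a j * w j k)" for k
  have A0: "A k \<ge> 0" for k
    using order_trans[OF mult_nonneg_nonneg[OF a(4) w(1)] ub] by (simp add: A_def)
  have AN: "A k \<le> N" for k
    unfolding A_def by (rule cSUP_least) (auto intro: le_N)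
  \<comment> \<open>A positive supremum exceeds its half, so some term does too; a supremum equal to
    0 is treated apart.\<close>
  have "\<exists>j. A k \<le> 2 * (a j * w j k)" for k
  proof (cases "A k = 0")
    case True
    then show ?thesis using a(4)[of 0] w(1)[of 0 k] by (auto intro!: exI[of _ 0])
  next
    case False
    then have "A k / 2 < A k" using A0[of k] by auto
    then obtain j where "A k / 2 < a j * w j k"
      unfolding A_def by (subst (asm) less_cSUP_iff[OF _ bdd]) auto
    then show ?thesis by (intro exI[of _ j]) auto
  qed
  then obtain f where f: "\<And>k. A k \<le> 2 * (a (f k) * w (f k) k)" by metis
  show "seq_norm_le r (\<lambda>k. SUP j. a j * w j k) (2 * C * N)"
  proof (cases "r = \<infinity>")
    case True
    have "N \<le> 2 * C * N" using C a(3) mult_right_mono[of 1 "2 * C" N] by auto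
    then show ?thesis using AN True by (auto simp: seq_norm_le_def A_def intro: order_trans)
  next
    case False
    define R where "R = enn2real r"
    have R: "R \<ge> 1" using enn2real_ge_1[OF False a(2)] by (simp add: R_def)
    have "(\<Sum>k\<in>F. A k powr R) \<le> (2 * C * N) powr R" if F: "finite F" for F
    proof -
      have "(\<Sum>k\<in>F. A k powr R) \<le> (\<Sum>k\<in>F. 2 powr R * (a (f k) powr R * w (f k) k))"
      proof (rule sum_mono)
        fix k
        have "A k powr R \<le> (2 * (a (f k) * w (f k) k)) powr R"
          using A0 f R by (intro powr_mono2) auto
        also have "\<dots> = 2 powr R * (a (f k) powr R * w (f k) k powr R)"
          using a w by (simp add: powr_mult)
        \<comment> \<open>Weights in [0, 1] and R \<ge> 1 let the exponent be dropped, after which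
          the bound on sums of weights applies.\<close>
        also have "w (f k) k powr R \<le> w (f k) k powr 1"
          using w R by (intro powr_mono') auto
        finally show "A k powr R \<le> 2 powr R * (a (f k) powr R * w (f k) k)"
          using w[of "f k" k] by (simp add: mult_left_mono)
      qed
      also have "\<dots> = 2 powr R * (\<Sum>j\<in>f ` F. \<Sum>k\<in>{k\<in>F. f k = j}. a (f k) powr R * w (f k) k)"
        using F by (simp add: sum.image_gen[of F _ f] sum_distrib_left)
      also have "\<dots> = 2 powr R * (\<Sum>j\<in>f ` F. a j powr R * (\<Sum>k\<in>{k\<in>F. f k = j}. w j k))"
        by (simp add: sum_distrib_left)
      also have "\<dots> \<le> 2 powr R * (\<Sum>j\<in>f ` F. a j powr R * C)"
        using F by (intro mult_left_mono sum_mono C(2)) auto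
      also have "\<dots> \<le> 2 powr R * (N powr R * C)"
        using a(1) F False C by (auto simp: seq_norm_le_def R_def simp flip: sum_distrib_right intro!: mult_right_mono)
      \<comment> \<open>From C \<ge> 1 follows C \<le> C powr R, which puts C inside the R-th
        power.\<close>
      also have "\<dots> \<le> 2 powr R * (N powr R * C powr R)"
        using C R powr_mono[of 1 R C] by (intro mult_left_mono) auto
      finally show ?thesis
        using C a by (simp add: powr_mult mult_ac)
    qed
    then show ?thesis using False by (simp add: seq_norm_le_def R_def A_def)
  qed
qed

text \<open>Hoelder's inequality: both sequences are normalised by their bounds, and Young's
  inequality with weights l and m is applied termwise. An infinite exponent gets weight 0.\<close>

lemma seq_norm_le_holder:
  assumes A: "seq_norm_le r0 A N" "r0 \<ge> 1" "0 \<le> N" "\<And>k. 0 \<le> A k"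
    and B: "seq_norm_le r1 B M" "r1 \<ge> 1" "0 \<le> M" "\<And>k. 0 \<le> B k"
    and \<theta>: "0 < \<theta>" "\<theta> < 1" and r: "r \<ge> 1" "recip r = (1 - \<theta>) * recip r0 + \<theta> * recip r1"
  shows "seq_norm_le r (\<lambda>k. A k powr (1 - \<theta>) * B k powr \<theta>) (N powr (1 - \<theta>) * M powr \<theta>)"
proof -
  have AN: "A k \<le> N" for k using seq_norm_le_pointwise[OF A(1,2) A(4) A(3)] .
  have BM: "B k \<le> M" for k using seq_norm_le_pointwise[OF B(1,2) B(4) B(3)] .
  show ?thesis
  \<comment> \<open>Normalisation would divide by 0 here, but then one sequence vanishes and so does
    every product, since \<open>0 powr x = 0\<close>.\<close>
  proof (cases "N = 0 \<or> M = 0")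
    case True
    then have "A k = 0 \<or> B k = 0" for k using AN[of k] BM[of k] A(4)[of k] B(4)[of k] by auto
    then have "A k powr (1 - \<theta>) * B k powr \<theta> = 0" for k
      by (metis mult_eq_0_iff powr_0)
    then have "(\<lambda>k. A k powr (1 - \<theta>) * B k powr \<theta>) = (\<lambda>_. 0)" by blast
    moreover have "seq_norm_le r (\<lambda>_. 0) (N powr (1 - \<theta>) * M powr \<theta>)" by (simp add: seq_norm_le_def)
    ultimately show ?thesis by simp
  next
    case False
    then have NM: "N > 0" "M > 0" using A B by auto
    consider "r = \<infinity>" | "r \<noteq> \<infinity>" by auto
    then show ?thesis
    proof cases
      case 1
      then show ?thesis
        using AN BM A(4) B(4) \<theta> by (auto simp: seq_norm_le_def intro!: mult_mono powr_mono2)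
    next
      case 2
      define R where "R = enn2real r"
      have R: "R \<ge> 1" "recip r = 1 / R" using 2 r enn2real_ge_1 recip_eq by (auto simp: R_def)
      \<comment> \<open>The relation between the reciprocals, multiplied by R, says that l + m =
        1.\<close>
      define l m where "l = R * ((1 - \<theta>) * recip r0)" "m = R * (\<theta> * recip r1)"
      have lm: "0 \<le> l" "0 \<le> m" "l + m = 1"
        using R r(2) \<theta> recip_bounds[OF A(2)] recip_bounds[OF B(2)]
        by (auto simp: l_m_def simp flip: distrib_left)
      \<comment> \<open>For an infinite exponent the value 0 is a placeholder: its weight is 0, and
        the corresponding normalised factor is at most 1.\<close>
      define S T where "S k = (if r0 = \<infinity> then 0 else (A k / N) powr enn2real r0)"
        and "T k = (if r1 = \<infinity> then 0 else (B k / M) powr enn2real r1)" for k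
      have st: "(A k / N) powr (R * (1 - \<theta>)) * (B k / M) powr (R * \<theta>) \<le> l * S k + m * T k" for k
      proof -
        have a: "0 \<le> A k / N" "A k / N \<le> 1" "0 \<le> B k / M" "B k / M \<le> 1"
          using AN BM A(4) B(4) NM by auto
        have pa: "0 \<le> (A k / N) powr (R * (1 - \<theta>))" "(A k / N) powr (R * (1 - \<theta>)) \<le> 1"
          using a R \<theta> by (auto intro!: powr_le1)
        have pb: "0 \<le> (B k / M) powr (R * \<theta>)" "(B k / M) powr (R * \<theta>) \<le> 1"
          using a R \<theta> by (auto intro!: powr_le1)
        have ea: "(A k / N) powr (R * (1 - \<theta>)) = S k powr l" if "r0 \<noteq> \<infinity>"
          using that recip_eq[OF that A(2)] enn2real_ge_1[OF that A(2)]
          by (simp add: S_def T_def l_m_def powr_powr)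
        have eb: "(B k / M) powr (R * \<theta>) = T k powr m" if "r1 \<noteq> \<infinity>"
          using that recip_eq[OF that B(2)] enn2real_ge_1[OF that B(2)]
          by (simp add: S_def T_def l_m_def powr_powr)
        consider "r0 = \<infinity>" | "r1 = \<infinity>" | "r0 \<noteq> \<infinity>" "r1 \<noteq> \<infinity>" by auto
        then show ?thesis
        proof cases
          case 1
          then have "l = 0" "m = 1" using lm by (auto simp: l_m_def)
          moreover then have "r1 \<noteq> \<infinity>" by (auto simp: l_m_def)
          ultimately show ?thesis
            using eb pa pb mult_right_mono[OF pa(2) pb(1)] by (auto simp: S_def T_def)
        next
          case 2
          then have "m = 0" "l = 1" using lm by (auto simp: l_m_def)
          moreover then have "r0 \<noteq> \<infinity>" by (auto simp: l_m_def)
          ultimately show ?thesis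
            using ea pa pb mult_left_mono[OF pb(2) pa(1)] by (auto simp: S_def T_def)
        next
          case 3
          show ?thesis
            unfolding ea[OF 3(1)] eb[OF 3(2)]
          \<comment> \<open>Young's inequality is applied to positive numbers; if one of them is 0,
            the left side vanishes.\<close>
          proof (cases "S k = 0 \<or> T k = 0")
            case True
            then have "S k powr l * T k powr m = 0" by auto
            moreover have "0 \<le> l * S k + m * T k"
              using lm by (simp add: S_def T_def)
            ultimately show "S k powr l * T k powr m \<le> l * S k + m * T k" by (simp only:)
          next
            case False
            then show "S k powr l * T k powr m \<le> l * S k + m * T k"
              using lm by (intro Youngs_inequality_0) (auto simp: S_def T_def)
          qed
        qed
      qed
      have "(\<Sum>k\<in>F. (A k powr (1 - \<theta>) * B k powr \<theta>) powr R) \<le> (N powr (1 - \<theta>) * M powr \<theta>) powr R"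
        if F: "finite F" for F
      proof -
        have "(\<Sum>k\<in>F. (A k / N) powr (R * (1 - \<theta>)) * (B k / M) powr (R * \<theta>)) \<le> (\<Sum>k\<in>F. l * S k + m * T k)"
          by (intro sum_mono st)
        also have "\<dots> = l * (\<Sum>k\<in>F. S k) + m * (\<Sum>k\<in>F. T k)"
          by (simp add: sum.distrib sum_distrib_left)
        also have "\<dots> \<le> l * 1 + m * 1"
        proof (intro add_mono mult_left_mono lm)
          show "(\<Sum>k\<in>F. S k) \<le> 1"
            using A(1) F NM A(4) by (cases "r0 = \<infinity>") (auto simp: S_def seq_norm_le_def powr_divide simp flip: sum_divide_distrib)
          show "(\<Sum>k\<in>F. T k) \<le> 1"
            using B(1) F NM B(4) by (cases "r1 = \<infinity>") (auto simp: T_def seq_norm_le_def powr_divide simp flip: sum_divide_distrib)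
        qed
        finally have le1: "(\<Sum>k\<in>F. (A k / N) powr (R * (1 - \<theta>)) * (B k / M) powr (R * \<theta>)) \<le> 1"
          using lm by simp
        have "(A k powr (1 - \<theta>) * B k powr \<theta>) powr R = (N powr (1 - \<theta>) * M powr \<theta>) powr R *
           ((A k / N) powr (R * (1 - \<theta>)) * (B k / M) powr (R * \<theta>))" for k
          using NM A(4)[of k] B(4)[of k] by (simp add: powr_mult powr_powr powr_divide mult_ac)
        then have "(\<Sum>k\<in>F. (A k powr (1 - \<theta>) * B k powr \<theta>) powr R) = (N powr (1 - \<theta>) * M powr \<theta>) powr R *
           (\<Sum>k\<in>F. (A k / N) powr (R * (1 - \<theta>)) * (B k / M) powr (R * \<theta>))"
          by (simp add: sum_distrib_left)
        also have "\<dots> \<le> (N powr (1 - \<theta>) * M powr \<theta>) powr R * 1"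
          by (intro mult_left_mono le1) auto
        finally show ?thesis by simp
      qed
      then show ?thesis using 2 by (auto simp: seq_norm_le_def R_def)
    qed
  qed
qed

text \<open>Each minimum is at most A k powr (1 - \<theta>) * B k powr \<theta> times a factor
  decaying in j, where A and B are weighted suprema of a and b. Decay in j bounds the sum for fixed
  k. Decay of the weights in k, where \<kappa> \<noteq> 0 enters, controls the norms of A and B, and
  Hoelder's inequality bounds h.\<close>

lemma discrete_interpolation:
  fixes \<alpha> \<beta> \<theta> \<kappa> :: real and r0 r1 r :: ennreal
  assumes pos: "\<alpha> > 0" "\<beta> > 0" "\<kappa> \<noteq> 0" and \<theta>: "\<theta> = \<alpha> / (\<alpha> + \<beta>)"
    and r: "r0 \<ge> 1" "r1 \<ge> 1" "r \<ge> 1" "recip r = (1 - \<theta>) * recip r0 + \<theta> * recip r1"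
  shows "\<exists>C\<ge>0. \<forall>a b N M. (\<forall>j. 0 \<le> a j) \<longrightarrow> (\<forall>j. 0 \<le> b j) \<longrightarrow> 0 \<le> N \<longrightarrow> 0 \<le> M \<longrightarrow>
     seq_norm_le r0 a N \<longrightarrow> seq_norm_le r1 b M \<longrightarrow>
     (\<exists>h. (\<forall>k. 0 \<le> h k) \<and> seq_norm_le r h (C * N powr (1 - \<theta>) * M powr \<theta>) \<and>
       (\<forall>k F. finite F \<longrightarrow> (\<Sum>j\<in>F. min (2 powr (\<alpha> * (\<kappa> * of_int k - of_int j)) * a j)
                                  (2 powr (- \<beta> * (\<kappa> * of_int k - of_int j)) * b j)) \<le> h k))"
proof -
  define \<gamma> where "\<gamma> = \<alpha> + \<beta>"
  have \<gamma>: "\<gamma> > 0" "\<alpha> = \<theta> * \<gamma>" using pos \<theta> by (auto simp: \<gamma>_def)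
  have \<theta>01: "0 < \<theta>" "\<theta> < 1" using pos by (auto simp: \<theta> field_simps)
  \<comment> \<open>The largest \<epsilon> that \<open>min_powr_le\<close> admits.\<close>
  define \<epsilon> where "\<epsilon> = min \<theta> (1 - \<theta>) / 2"
  have \<epsilon>: "0 < \<epsilon>" "2 * \<epsilon> \<le> \<theta>" "2 * \<epsilon> \<le> 1 - \<theta>" using \<theta>01 by (auto simp: \<epsilon>_def)
  obtain C1 where C1: "C1 \<ge> 1"
    "\<And>t F. finite F \<Longrightarrow> (\<Sum>j\<in>F. 2 powr (- (\<epsilon> * \<gamma> * \<bar>t - real_of_int j\<bar>))) \<le> C1"
    using sum_exp_decay_le[of "\<epsilon> * \<gamma>"] \<epsilon> \<gamma> by auto
  obtain C2 where C2: "C2 \<ge> 1"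
    "\<And>t F. finite F \<Longrightarrow> (\<Sum>j\<in>F. 2 powr (- (\<epsilon> * \<gamma> * \<bar>\<kappa>\<bar> * \<bar>t - real_of_int j\<bar>))) \<le> C2"
    using sum_exp_decay_le[of "\<epsilon> * \<gamma> * \<bar>\<kappa>\<bar>"] \<epsilon> \<gamma> pos by auto
  \<comment> \<open>\<open>C1\<close> comes from the sum over j. Each weighted supremum loses
    \<open>2 * C2\<close>, and the two losses enter with exponents 1 - \<theta> and
    \<theta>.\<close>
  define C where "C = C1 * (2 * C2)"
  have C: "C \<ge> 0" using C1 C2 by (auto simp: C_def)
  show ?thesis
  proof (intro exI[of _ C] conjI C allI impI)
    fix a b :: "int \<Rightarrow> real" and N M :: real
    assume ab: "\<forall>j. 0 \<le> a j" "\<forall>j. 0 \<le> b j" and NM: "0 \<le> N" "0 \<le> M"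
      and lr: "seq_norm_le r0 a N" "seq_norm_le r1 b M"
    let ?e = "\<lambda>k j. min (2 powr (\<alpha> * (\<kappa> * of_int k - of_int j)) * a j)
                                  (2 powr (- \<beta> * (\<kappa> * of_int k - of_int j)) * b j)"
    show "\<exists>h. (\<forall>k. 0 \<le> h k) \<and> seq_norm_le r h (C * N powr (1 - \<theta>) * M powr \<theta>) \<and>
       (\<forall>k F. finite F \<longrightarrow> (\<Sum>j\<in>F. ?e k j) \<le> h k)"
    \<comment> \<open>If no index has both coefficients positive, all minima are 0 and h = 0 works.
      Otherwise one such index makes every A k and B k positive, so that their logarithms make
      sense.\<close>
    proof (cases "\<exists>j. a j > 0 \<and> b j > 0")
      case False
      then have "a j = 0 \<or> b j = 0" for j using ab by (metis order_le_less)
      then have "?e k j = 0" for k j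
        using ab by (metis min_def mult_nonneg_nonneg mult_zero_right order_antisym powr_ge_zero)
      then show ?thesis
        using C by (intro exI[of _ "\<lambda>_. 0"]) (auto simp: seq_norm_le_def)
    next
      case True
      then obtain j0 where j0: "a j0 > 0" "b j0 > 0" by auto
      \<comment> \<open>The weight decays with the distance from the point where the two terms of
        the minimum agree. It is 0 where a logarithm of 0 would appear.\<close>
      define w where "w j k = (if a j > 0 \<and> b j > 0
         then 2 powr (- (\<epsilon> * \<bar>\<gamma> * (\<kappa> * of_int k - of_int j) + log 2 (a j) - log 2 (b j)\<bar>)) else 0)" for j k :: int
      have w: "0 \<le> w j k" "w j k \<le> 1" for j k
        using \<epsilon> powr_mono[of "- (\<epsilon> * \<bar>\<gamma> * (\<kappa> * of_int k - of_int j) + log 2 (a j) - log 2 (b j)\<bar>)" 0 2]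
        by (auto simp: w_def)
      have wsum: "(\<Sum>k\<in>F. w j k) \<le> C2" if "finite F" for j F
      proof (cases "a j > 0 \<and> b j > 0")
        case True
        \<comment> \<open>The real value of k at which the two terms of the minimum with index j
          agree.\<close>
        define t where "t = (of_int j - (log 2 (a j) - log 2 (b j)) / \<gamma>) / \<kappa>"
        have "\<bar>\<gamma> * (\<kappa> * of_int k - of_int j) + log 2 (a j) - log 2 (b j)\<bar> = \<gamma> * \<bar>\<kappa>\<bar> * \<bar>t - of_int k\<bar>" for k
        proof -
          have "\<gamma> * (\<kappa> * of_int k - of_int j) + log 2 (a j) - log 2 (b j) = \<gamma> * \<kappa> * (of_int k - t)"
            using \<gamma>(1) pos(3) by (simp add: t_def field_simps)
          then show ?thesis using \<gamma>(1) by (simp add: abs_mult abs_minus_commute)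
        qed
        then have "(\<Sum>k\<in>F. w j k) = (\<Sum>k\<in>F. 2 powr (- (\<epsilon> * \<gamma> * \<bar>\<kappa>\<bar> * \<bar>t - real_of_int k\<bar>)))"
          using True by (simp add: w_def mult.assoc)
        also have "\<dots> \<le> C2" by (rule C2(2)[OF that])
        finally show ?thesis .
      qed (use C2(1) in \<open>auto simp: w_def\<close>)
      define A where "A k = (SUP j. a j * w j k)" for k
      define B where "B k = (SUP j. b j * w j k)" for k
      have A: "a j * w j k \<le> A k" "seq_norm_le r0 A (2 * C2 * N)" for j k
        unfolding A_def using seq_norm_le_weighted_sup[OF lr(1) r(1) NM(1) _ w C2(1) wsum] ab by auto
      have B: "b j * w j k \<le> B k" "seq_norm_le r1 B (2 * C2 * M)" for j k
        unfolding B_def using seq_norm_le_weighted_sup[OF lr(2) r(2) NM(2) _ w C2(1) wsum] ab by auto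
      have A0: "A k > 0" for k
        using A(1)[of j0 k] j0 by (rule_tac less_le_trans) (auto simp: w_def)
      have B0: "B k > 0" for k
        using B(1)[of j0 k] j0 by (rule_tac less_le_trans) (auto simp: w_def)
      define h where "h k = C1 * (A k powr (1 - \<theta>) * B k powr \<theta>)" for k
      have "seq_norm_le r (\<lambda>k. A k powr (1 - \<theta>) * B k powr \<theta>) ((2 * C2 * N) powr (1 - \<theta>) * (2 * C2 * M) powr \<theta>)"
        using A0 B0 C2(1) NM by (intro seq_norm_le_holder[OF A(2) r(1) _ _ B(2) r(2) _ _ \<theta>01 r(3,4)])
            (auto intro: less_imp_le)
      also have "(2 * C2 * N) powr (1 - \<theta>) * (2 * C2 * M) powr \<theta> = ((2 * C2) powr (1 - \<theta>) * (2 * C2) powr \<theta>) * (N powr (1 - \<theta>) * M powr \<theta>)"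
        using C2(1) NM by (simp add: powr_mult)
      also have "(2 * C2) powr (1 - \<theta>) * (2 * C2) powr \<theta> = 2 * C2"
        using C2(1) by (simp flip: powr_add)
      finally have "seq_norm_le r h (C1 * (2 * C2 * (N powr (1 - \<theta>) * M powr \<theta>)))"
        unfolding h_def using C1 C2 by (intro seq_norm_le_scale) auto
      moreover have "0 \<le> h k" for k using C1 by (auto simp: h_def)
      moreover have "(\<Sum>j\<in>F. ?e k j) \<le> h k" if F: "finite F" for k F
      proof -
        \<comment> \<open>With A k and B k in place of a j and b j the centre of the decay depends
          on k alone, so \<open>C1\<close> bounds the sum over j.\<close>
        have "?e k j \<le> A k powr (1 - \<theta>) * B k powr \<theta> *
           2 powr (- (\<epsilon> * \<gamma> * \<bar>(\<kappa> * of_int k + (log 2 (A k) - log 2 (B k)) / \<gamma>) - of_int j\<bar>))" for j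
        proof (cases "a j > 0 \<and> b j > 0")
          case True
          have "\<bar>\<gamma> * (\<kappa> * of_int k - of_int j) + log 2 (A k) - log 2 (B k)\<bar>
            = \<bar>\<gamma> * ((\<kappa> * of_int k + (log 2 (A k) - log 2 (B k)) / \<gamma>) - of_int j)\<bar>"
            using \<gamma>(1) by (simp add: right_diff_distrib distrib_left diff_divide_distrib)
          then have eq: "\<bar>\<gamma> * (\<kappa> * of_int k - of_int j) + log 2 (A k) - log 2 (B k)\<bar>
            = \<gamma> * \<bar>(\<kappa> * of_int k + (log 2 (A k) - log 2 (B k)) / \<gamma>) - of_int j\<bar>"
            using \<gamma>(1) by (simp add: abs_mult)
          have "?e k j \<le> A k powr (1 - \<theta>) * B k powr \<theta> *
             2 powr (- (\<epsilon> * \<bar>\<gamma> * (\<kappa> * of_int k - of_int j) + log 2 (A k) - log 2 (B k)\<bar>))"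
            unfolding \<gamma>_def
          proof (rule min_powr_le[OF _ _ A0 B0 _ \<epsilon>])
            show "\<alpha> = \<theta> * (\<alpha> + \<beta>)" using \<gamma>(2) by (simp only: \<gamma>_def)
          qed (use True A(1)[of j k] B(1)[of j k] in \<open>simp_all add: w_def \<gamma>_def\<close>)
          then show ?thesis unfolding eq by (simp only: mult.assoc)
        next
          case False
          then have "a j = 0 \<or> b j = 0" using ab by (metis order_le_less)
          then have "?e k j \<le> 0" by (auto simp: min_def)
          then show ?thesis by (rule order_trans) auto
        qed
        then have "(\<Sum>j\<in>F. ?e k j) \<le> A k powr (1 - \<theta>) * B k powr \<theta> * (\<Sum>j\<in>F.
           2 powr (- (\<epsilon> * \<gamma> * \<bar>(\<kappa> * of_int k + (log 2 (A k) - log 2 (B k)) / \<gamma>) - of_int j\<bar>)))"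
          unfolding sum_distrib_left by (rule sum_mono)
        also have "\<dots> \<le> A k powr (1 - \<theta>) * B k powr \<theta> * C1"
          by (intro mult_left_mono C1(2) F) auto
        finally show ?thesis by (simp add: h_def mult_ac)
      qed
      ultimately show ?thesis by (auto simp: C_def mult.assoc)
    qed
  qed
qed

section \<open>Rearrangements\<close>

lemma epow_ennreal: "0 \<le> y \<Longrightarrow> ennreal y ^\<^sub>e a = ennreal (y powr a)"
  by (simp add: epow_def)

lemma epow_mono:
  assumes "0 \<le> a" "x \<le> y"
  shows "x ^\<^sub>e a \<le> y ^\<^sub>e a"
proof (cases y)
  case (real v)
  then obtain u where "x = ennreal u" "0 \<le> u" using assms(2) by (cases x) (auto simp: top_unique)
  with real assms show ?thesis by (simp add: epow_ennreal ennreal_leI powr_mono2)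
qed (auto simp: epow_def)

lemma epow_inverse_le_iff:
  assumes "0 < R" "0 \<le> N"
  shows "X ^\<^sub>e (1 / R) \<le> ennreal N \<longleftrightarrow> X \<le> ennreal (N powr R)"
proof (cases X)
  case (real x)
  have "x powr (1 / R) \<le> N \<longleftrightarrow> x \<le> N powr R"
  proof
    assume "x powr (1 / R) \<le> N"
    then have "(x powr (1 / R)) powr R \<le> N powr R" using assms by (intro powr_mono2) auto
    then show "x \<le> N powr R" using assms real by (simp add: powr_powr)
  next
    assume "x \<le> N powr R"
    then have "x powr (1 / R) \<le> (N powr R) powr (1 / R)" using assms real by (intro powr_mono2) auto
    then show "x powr (1 / R) \<le> N" using assms by (simp add: powr_powr)
  qed
  then show ?thesis using real assms by (simp add: epow_ennreal)
qed (auto simp: epow_def top_unique)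

text \<open>Sums over the integers are written as integrals for the counting measure, so that
  Tonelli's theorem applies to them; the enumeration \<open>int_decode\<close> links them to
  series.\<close>

lemma nn_integral_int_eq_suminf:
  fixes f :: "int \<Rightarrow> ennreal"
  shows "(\<integral>\<^sup>+j. f j \<partial>count_space UNIV) = (\<Sum>n. f (int_decode n))"
  by (subst nn_integral_bij_count_space[OF bij_int_decode, symmetric]) (rule nn_integral_count_space_nat)

lemma borel_measurable_nn_integral_int:
  fixes f :: "int \<Rightarrow> 'a \<Rightarrow> ennreal"
  assumes [measurable]: "\<And>j. f j \<in> borel_measurable M"
  shows "(\<lambda>x. \<integral>\<^sup>+j. f j x \<partial>count_space UNIV) \<in> borel_measurable M"
  unfolding nn_integral_int_eq_suminf by measurable

lemma nn_integral_int_le: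
  fixes f :: "int \<Rightarrow> ennreal"
  assumes "\<And>F. finite F \<Longrightarrow> sum f F \<le> B"
  shows "(\<integral>\<^sup>+j. f j \<partial>count_space UNIV) \<le> B"
proof -
  have "(\<integral>\<^sup>+j. f j \<partial>count_space UNIV) = (\<Sum>n. f (int_decode n))" by (rule nn_integral_int_eq_suminf)
  also have "\<dots> = (SUP N. \<Sum>n<N. f (int_decode n))" by (rule suminf_eq_SUP)
  also have "\<dots> \<le> B"
  proof (rule SUP_least)
    fix N :: nat
    have "(\<Sum>n<N. f (int_decode n)) = sum f (int_decode ` {..<N})"
      using inj_int_decode by (subst sum.reindex) (auto intro: inj_on_subset)
    also have "\<dots> \<le> B" by (rule assms) simp
    finally show "(\<Sum>n<N. f (int_decode n)) \<le> B" .
  qed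
  finally show ?thesis .
qed

text \<open>Above a level L > 0 one has y \<le> L powr (1 - Q) * y powr Q because Q \<ge> 1, so the
  integral of the Q-th power controls the excess. For q = \<infinity> the level is N itself and the
  excess vanishes almost everywhere.\<close>

lemma nn_integral_excess_le:
  fixes g :: "real^'n \<Rightarrow> complex"
  assumes g[measurable]: "g \<in> borel_measurable lebesgue" and q: "q \<ge> 1"
    and N: "Lq_norm q g \<le> ennreal N" "0 \<le> N" and s: "s > 0"
  shows "(\<integral>\<^sup>+x. ennreal (max 0 (norm (g x) - N * s powr (- recip q))) \<partial>lebesgue) \<le> ennreal (N * s powr (1 - recip q))"
proof (cases "q = \<infinity>")
  case True
  have "AE x in lebesgue. ennreal (norm (g x)) \<le> esssup lebesgue (\<lambda>x. ennreal (norm (g x)))"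
    by (rule esssup_AE)
  then have "AE x in lebesgue. ennreal (max 0 (norm (g x) - N * s powr (- recip q))) = 0"
  proof eventually_elim
    case (elim x)
    then have "ennreal (norm (g x)) \<le> ennreal N" using N(1) True by (auto simp: Lq_norm_def)
    then show ?case using True N s by simp
  qed
  then have "(\<integral>\<^sup>+x. ennreal (max 0 (norm (g x) - N * s powr (- recip q))) \<partial>lebesgue) = (\<integral>\<^sup>+_. 0 \<partial>(lebesgue :: (real^'n) measure))"
    by (rule nn_integral_cong_AE)
  then show ?thesis by simp
next
  case False
  define Q where "Q = enn2real q"
  have Q: "Q \<ge> 1" "recip q = 1 / Q" using enn2real_ge_1[OF False q] recip_eq[OF False q] by (auto simp: Q_def)
  have X: "(\<integral>\<^sup>+x. ennreal (norm (g x) powr Q) \<partial>lebesgue) \<le> ennreal (N powr Q)"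
    using N False Q epow_inverse_le_iff[of Q N] by (simp add: Lq_norm_def Q_def epow_ennreal)
  show ?thesis
  \<comment> \<open>The power L powr (1 - Q) is of use only for L > 0, that is for N > 0.\<close>
  proof (cases "N = 0")
    case True
    then have "(\<integral>\<^sup>+x. ennreal (norm (g x) powr Q) \<partial>lebesgue) = 0" using X by simp
    then have "AE x in lebesgue. ennreal (norm (g x) powr Q) = 0"
      by (subst (asm) nn_integral_0_iff_AE) auto
    then have "AE x in lebesgue. ennreal (max 0 (norm (g x) - N * s powr (- recip q))) = 0"
      by eventually_elim (use True in auto)
    then have "(\<integral>\<^sup>+x. ennreal (max 0 (norm (g x) - N * s powr (- recip q))) \<partial>lebesgue) = (\<integral>\<^sup>+_. 0 \<partial>(lebesgue :: (real^'n) measure))"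
      by (rule nn_integral_cong_AE)
    then show ?thesis by simp
  next
    case False
    define L where "L = N * s powr (- recip q)"
    have L: "L > 0" using False N s by (simp add: L_def)
    have "(\<integral>\<^sup>+x. ennreal (max 0 (norm (g x) - L)) \<partial>lebesgue) \<le>
        (\<integral>\<^sup>+x. ennreal (L powr (1 - Q)) * ennreal (norm (g x) powr Q) \<partial>lebesgue)"
    proof (rule nn_integral_mono)
      fix x
      have "max 0 (norm (g x) - L) \<le> L powr (1 - Q) * norm (g x) powr Q"
      proof (cases "norm (g x) \<le> L")
        case False
        then have gx: "norm (g x) > 0" using L by linarith
        have "norm (g x) = norm (g x) powr (1 - Q) * norm (g x) powr Q"
          using gx by (simp flip: powr_add)
        also have "\<dots> \<le> L powr (1 - Q) * norm (g x) powr Q"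
          using False L Q by (intro mult_right_mono powr_mono2') auto
        finally show ?thesis using L by simp
      qed simp
      then show "ennreal (max 0 (norm (g x) - L)) \<le> ennreal (L powr (1 - Q)) * ennreal (norm (g x) powr Q)"
        by (simp add: ennreal_leI flip: ennreal_mult)
    qed
    also have "\<dots> = ennreal (L powr (1 - Q)) * (\<integral>\<^sup>+x. ennreal (norm (g x) powr Q) \<partial>lebesgue)"
      by (rule nn_integral_cmult) measurable
    also have "\<dots> \<le> ennreal (L powr (1 - Q)) * ennreal (N powr Q)"
      by (intro mult_left_mono X) auto
    also have "\<dots> = ennreal (L powr (1 - Q) * N powr Q)" by (simp flip: ennreal_mult)
    also have "L powr (1 - Q) * N powr Q = N * s powr (1 - recip q)"
    proof -
      have "L powr (1 - Q) = N powr (1 - Q) * s powr (1 - recip q)"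
      proof -
        have "- recip q * (1 - Q) = 1 - recip q" using Q by (simp add: field_simps)
        then show ?thesis using N s by (simp add: L_def powr_mult powr_powr)
      qed
      moreover have "N powr (1 - Q) * N powr Q = N" using False N by (simp flip: powr_add)
      ultimately show ?thesis by (simp add: mult_ac)
    qed
    finally show ?thesis by (simp add: L_def)
  qed
qed

lemma rearrangement_antimono: "s \<le> t \<Longrightarrow> rearrangement g t \<le> rearrangement g s"
  unfolding rearrangement_def by (intro Inf_superset_mono image_mono) (auto intro: order_trans ennreal_leI)

text \<open>The levels add up to a part bounded by H, and the sum W of the excesses has integral at
  most s H by Tonelli's theorem. This splitting into a bounded and an integrable part serves both
  the rearrangement bound and the convergence of the series of blocks.\<close>

lemma sum_norm_le_plus_excess:
  fixes g :: "int \<Rightarrow> real^'n \<Rightarrow> complex"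
  assumes [measurable]: "\<And>j. g j \<in> borel_measurable lebesgue"
    and c: "\<And>j. 0 \<le> c j" "\<And>F. finite F \<Longrightarrow> sum c F \<le> H" and s: "s > 0"
    and ex: "\<And>j. (\<integral>\<^sup>+x. ennreal (max 0 (norm (g j x) - c j)) \<partial>lebesgue) \<le> ennreal (c j * s)"
  obtains W where "W \<in> borel_measurable lebesgue" "(\<integral>\<^sup>+x. W x \<partial>lebesgue) \<le> ennreal (s * H)"
    "\<And>x. (\<integral>\<^sup>+j. ennreal (norm (g j x)) \<partial>count_space UNIV) \<le> ennreal H + W x"
proof -
  have H: "0 \<le> H" using c(2)[of "{}"] by simp
  define W where "W x = (\<integral>\<^sup>+j. ennreal (max 0 (norm (g j x) - c j)) \<partial>count_space UNIV)" for x
  have sumc: "(\<integral>\<^sup>+j. ennreal (c j) \<partial>count_space UNIV) \<le> ennreal H"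
    by (rule nn_integral_int_le) (use c in \<open>simp add: ennreal_leI\<close>)
  have meas: "W \<in> borel_measurable lebesgue"
    unfolding W_def by (rule borel_measurable_nn_integral_int) measurable
  have "(\<integral>\<^sup>+x. W x \<partial>lebesgue) = (\<integral>\<^sup>+j. \<integral>\<^sup>+x. ennreal (max 0 (norm (g j x) - c j)) \<partial>lebesgue \<partial>count_space UNIV)"
    unfolding W_def by (rule nn_integral_count_space_nn_integral) auto
  also have "\<dots> \<le> (\<integral>\<^sup>+j. ennreal s * ennreal (c j) \<partial>count_space UNIV)"
    using ex c s by (intro nn_integral_mono) (simp add: mult.commute flip: ennreal_mult)
  also have "\<dots> = ennreal s * (\<integral>\<^sup>+j. ennreal (c j) \<partial>count_space UNIV)"
    by (rule nn_integral_cmult) simp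
  also have "\<dots> \<le> ennreal s * ennreal H" by (intro mult_left_mono sumc) auto
  finally have intW: "(\<integral>\<^sup>+x. W x \<partial>lebesgue) \<le> ennreal (s * H)"
    using s H by (simp add: ennreal_mult)
  have split: "(\<integral>\<^sup>+j. ennreal (norm (g j x)) \<partial>count_space UNIV) \<le> ennreal H + W x" for x
  proof -
    have "(\<integral>\<^sup>+j. ennreal (norm (g j x)) \<partial>count_space UNIV) \<le>
      (\<integral>\<^sup>+j. ennreal (c j) + ennreal (max 0 (norm (g j x) - c j)) \<partial>count_space UNIV)"
      using c by (intro nn_integral_mono) (auto simp: ennreal_leI simp flip: ennreal_plus)
    also have "\<dots> = (\<integral>\<^sup>+j. ennreal (c j) \<partial>count_space UNIV) + W x"
      unfolding W_def by (rule nn_integral_add) auto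
    finally show ?thesis using sumc by (meson add_right_mono order_trans)
  qed
  show ?thesis by (rule that[OF meas intW split])
qed

text \<open>Where |G| \<ge> 2 t with t \<ge> H, the integrable part W is at least t, and Markov's
  inequality bounds the measure of this set by s H / t \<le> s.\<close>

lemma rearrangement_le:
  fixes g :: "int \<Rightarrow> real^'n \<Rightarrow> complex" and G :: "real^'n \<Rightarrow> complex"
  assumes g: "\<And>j. g j \<in> borel_measurable lebesgue" and [measurable]: "G \<in> borel_measurable lebesgue"
    and c: "\<And>j. 0 \<le> c j" "\<And>F. finite F \<Longrightarrow> sum c F \<le> H" and s: "s > 0"
    and ex: "\<And>j. (\<integral>\<^sup>+x. ennreal (max 0 (norm (g j x) - c j)) \<partial>lebesgue) \<le> ennreal (c j * s)"
    and G: "AE x in lebesgue. ennreal (norm (G x)) \<le> (\<integral>\<^sup>+j. ennreal (norm (g j x)) \<partial>count_space UNIV)"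
  shows "rearrangement G s \<le> ennreal (2 * H)"
proof -
  have H: "0 \<le> H" using c(2)[of "{}"] by simp
  obtain W where [measurable]: "W \<in> borel_measurable lebesgue"
    and intW: "(\<integral>\<^sup>+x. W x \<partial>lebesgue) \<le> ennreal (s * H)"
    and split: "\<And>x. (\<integral>\<^sup>+j. ennreal (norm (g j x)) \<partial>count_space UNIV) \<le> ennreal H + W x"
    using sum_norm_le_plus_excess[OF g c s ex] by blast
  have dist: "distribution_fun G (2 * t) \<le> ennreal s" if t: "t > 0" "t \<ge> H" for t
  proof -
    have "distribution_fun G (2 * t) \<le> emeasure lebesgue {x\<in>UNIV. 1 \<le> ennreal (1 / t) * W x}"
      unfolding distribution_fun_def
    proof (rule emeasure_mono_AE)
      show "AE x in lebesgue. x \<in> {x. 2 * t \<le> norm (G x)} \<longrightarrow> x \<in> {x\<in>UNIV. 1 \<le> ennreal (1 / t) * W x}"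
        using G
      proof eventually_elim
        case (elim x)
        show ?case
        proof (intro impI, elim CollectE)
          assume "2 * t \<le> norm (G x)"
          then have "ennreal (2 * t) \<le> ennreal (norm (G x))" by (rule ennreal_leI)
          also have "\<dots> \<le> ennreal H + W x" using elim split by (rule order_trans)
          also have "\<dots> \<le> ennreal t + W x" using t by (intro add_right_mono ennreal_leI)
          finally have "ennreal t + ennreal t \<le> ennreal t + W x" using t by (simp flip: ennreal_plus)
          then have "ennreal t \<le> W x" by (simp add: ennreal_add_left_cancel_le)
          then have "ennreal (1 / t) * ennreal t \<le> ennreal (1 / t) * W x" by (rule mult_left_mono) simp
          then show "x \<in> {x\<in>UNIV. 1 \<le> ennreal (1 / t) * W x}" using t by (simp flip: ennreal_mult)
        qed
      qed
      have "{x\<in>space lebesgue. 1 \<le> ennreal (1 / t) * W x} \<in> sets lebesgue" by measurable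
      then show "{x\<in>UNIV. 1 \<le> ennreal (1 / t) * W x} \<in> sets lebesgue" by simp
    qed
    also have "\<dots> \<le> ennreal (1 / t) * (\<integral>\<^sup>+x. W x * indicator UNIV x \<partial>lebesgue)"
    proof (rule nn_integral_Markov_inequality)
      show "(UNIV :: (real^'n) set) \<in> sets lebesgue"
        using sets.top[of "lebesgue :: (real^'n) measure"]
        unfolding space_completion space_lborel space_borel .
    qed simp
    also have "\<dots> \<le> ennreal (1 / t) * ennreal (s * H)"
      using intW by (intro mult_left_mono) auto
    also have "\<dots> = ennreal (1 / t * (s * H))" using t s H by (simp flip: ennreal_mult)
    also have "\<dots> \<le> ennreal s"
      using t s H by (intro ennreal_leI) (simp add: field_simps)
    finally show ?thesis .
  qed
  show ?thesis
  proof (rule ennreal_le_epsilon)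
    fix e :: real assume e: "e > 0"
    \<comment> \<open>Adding e / 2 keeps the level positive even when H = 0.\<close>
    have "rearrangement G s \<le> ennreal (2 * (H + e / 2))"
      unfolding rearrangement_def using e H dist[of "H + e / 2"] by (intro Inf_lower imageI CollectI) auto
    also have "\<dots> = ennreal (2 * H) + ennreal e" using e H by (simp flip: ennreal_plus)
    finally show "rearrangement G s \<le> ennreal (2 * H) + ennreal e" .
  qed
qed

text \<open>On the interval from 2 powr k to 2 powr (k + 1) monotonicity bounds the rearrangement by
  its value at the left end, and s powr (1/p) grows by at most the factor 2 powr (1/p). The measure
  ds/s gives each such interval mass at most 1, so the integral is bounded by a sum over k.\<close>

lemma lorentz_norm_le_dyadic:
  assumes p: "p > 0" and r: "r \<ge> 1" and h: "\<And>k. 0 \<le> h k" "seq_norm_le r h M" "0 \<le> M"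
    and re: "\<And>k::int. rearrangement g (2 powr k) \<le> ennreal (2 * h k * 2 powr (- real_of_int k / p))"
  shows "lorentz_norm p r g \<le> ennreal (2 powr (1 / p) * 2 * M)"
proof -
  define D where "D = 2 powr (1 / p) * (2::real)"
  have D: "D > 0" by (simp add: D_def)
  have key: "ennreal (s powr (1 / p)) * rearrangement g s \<le> ennreal (D * h k)"
    if "2 powr k \<le> s" "s < 2 powr (k + 1)" for s and k :: int
  proof -
    have s: "s > 0" using that(1) by (rule less_le_trans[rotated]) simp
    have "s powr (1 / p) \<le> (2 powr (k + 1)) powr (1 / p)"
      using that s p by (intro powr_mono2) auto
    also have "\<dots> = 2 powr ((k + 1) / p)" by (simp add: powr_powr)
    finally have "ennreal (s powr (1 / p)) * rearrangement g s \<le>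
       ennreal (2 powr ((k + 1) / p)) * ennreal (2 * h k * 2 powr (- real_of_int k / p))"
      using order_trans[OF rearrangement_antimono[OF that(1)] re] by (intro mult_mono ennreal_leI) auto
    also have "\<dots> = ennreal (2 powr ((k + 1) / p) * (2 * h k * 2 powr (- real_of_int k / p)))"
      using h by (simp flip: ennreal_mult)
    also have "2 powr ((k + 1) / p) * (2 * h k * 2 powr (- real_of_int k / p)) = D * h k"
    proof -
      have "2 powr ((k + 1) / p) * 2 powr (- real_of_int k / p) = 2 powr (1 / p)"
        using p by (simp add: field_simps flip: powr_add)
      then show ?thesis by (simp add: D_def mult_ac)
    qed
    finally show ?thesis .
  qed
  have ex: "2 powr \<lfloor>log 2 s\<rfloor> \<le> s \<and> s < 2 powr (\<lfloor>log 2 s\<rfloor> + 1)" if "s > 0" for s :: real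
    using that by (auto simp: powr_le_iff less_powr_iff)
  show ?thesis
  proof (cases "r = \<infinity>")
    case True
    have "ennreal (s powr (1 / p)) * rearrangement g s \<le> ennreal (D * M)" if "s \<in> {0<..}" for s
    proof -
      have "ennreal (s powr (1 / p)) * rearrangement g s \<le> ennreal (D * h \<lfloor>log 2 s\<rfloor>)"
        using ex[of s] that by (intro key) auto
      also have "\<dots> \<le> ennreal (D * M)"
        using h(2) D True by (intro ennreal_leI mult_left_mono) (auto simp: seq_norm_le_def)
      finally show ?thesis .
    qed
    then show ?thesis using True by (auto simp: lorentz_norm_def D_def intro: SUP_least)
  next
    case False
    define R where "R = enn2real r"
    have R: "R \<ge> 1" using enn2real_ge_1[OF False r] by (simp add: R_def)
    define I :: "int \<Rightarrow> real set" where "I k = {2 powr k..<2 powr (k + 1)}" for k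
    have pt: "(ennreal (s powr (1 / p)) * rearrangement g s) ^\<^sub>e R / ennreal s * indicator {0<..} s
       \<le> (\<integral>\<^sup>+k. ennreal ((D * h k) powr R * 2 powr (- real_of_int k)) * indicator (I k) s \<partial>count_space UNIV)" for s
    proof (cases "s > 0")
      case True
      define k where "k = \<lfloor>log 2 s\<rfloor>"
      have k: "2 powr k \<le> s" "s < 2 powr (k + 1)" using ex[OF True] by (auto simp: k_def)
      have "(ennreal (s powr (1 / p)) * rearrangement g s) ^\<^sub>e R \<le> ennreal (D * h k) ^\<^sub>e R"
        using R by (intro epow_mono key k) auto
      also have "\<dots> = ennreal ((D * h k) powr R)" using D h by (intro epow_ennreal) auto
      finally have "(ennreal (s powr (1 / p)) * rearrangement g s) ^\<^sub>e R / ennreal s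
          \<le> ennreal ((D * h k) powr R) / ennreal s"
        by (rule divide_right_mono_ennreal)
      also have "\<dots> = ennreal ((D * h k) powr R * (1 / s))" using True by (simp add: divide_ennreal)
      also have "\<dots> \<le> ennreal ((D * h k) powr R * 2 powr (- real_of_int k))"
      proof (intro ennreal_leI mult_left_mono)
        show "1 / s \<le> 2 powr (- real_of_int k)"
          using k True by (simp add: powr_minus field_simps)
      qed simp
      also have "\<dots> = ennreal ((D * h k) powr R * 2 powr (- real_of_int k)) * indicator (I k) s"
        using k by (simp add: I_def)
      \<comment> \<open>A single term, written as an integral over a one-point space, to be compared
        with the sum over all integers.\<close>
      also have "\<dots> = (\<integral>\<^sup>+k. ennreal ((D * h k) powr R * 2 powr (- real_of_int k)) * indicator (I k) s \<partial>count_space {k})"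
        by (subst nn_integral_count_space_finite)
           (simp_all only: sum.insert sum.empty finite.emptyI finite.insertI empty_iff not_False_eq_True add_0_right)
      also have "\<dots> \<le> (\<integral>\<^sup>+k. ennreal ((D * h k) powr R * 2 powr (- real_of_int k)) * indicator (I k) s \<partial>count_space UNIV)"
        by (subst nn_integral_count_space_indicator) (auto intro!: nn_integral_mono simp: indicator_def)
      finally show ?thesis using True by simp
    qed simp
    have "(\<integral>\<^sup>+s\<in>{0<..}. (ennreal (s powr (1/p)) * rearrangement g s) ^\<^sub>e R / ennreal s \<partial>lborel)
      \<le> (\<integral>\<^sup>+s. \<integral>\<^sup>+k. ennreal ((D * h k) powr R * 2 powr (- real_of_int k)) * indicator (I k) s \<partial>count_space UNIV \<partial>lborel)"
      by (intro nn_integral_mono pt)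
    also have "\<dots> = (\<integral>\<^sup>+k. \<integral>\<^sup>+s. ennreal ((D * h k) powr R * 2 powr (- real_of_int k)) * indicator (I k) s \<partial>lborel \<partial>count_space UNIV)"
      by (rule nn_integral_count_space_nn_integral) (auto simp: I_def)
    also have "\<dots> = (\<integral>\<^sup>+k. ennreal ((D * h k) powr R) \<partial>count_space UNIV)"
    proof (rule nn_integral_cong)
      fix k :: int
      have "(\<integral>\<^sup>+s. ennreal ((D * h k) powr R * 2 powr (- real_of_int k)) * indicator (I k) s \<partial>lborel)
         = ennreal ((D * h k) powr R * 2 powr (- real_of_int k)) * ennreal (2 powr (k + 1) - 2 powr k)"
        by (simp add: nn_integral_cmult_indicator I_def)
      also have "\<dots> = ennreal ((D * h k) powr R * 2 powr (- real_of_int k) * (2 powr (k + 1) - 2 powr k))"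
        by (simp flip: ennreal_mult)
      \<comment> \<open>The bound 2 powr (- k) for 1/s cancels the length 2 powr k of the
        interval.\<close>
      also have "2 powr (- real_of_int k) * (2 powr (k + 1) - 2 powr k) = (1::real)"
        by (simp add: powr_add powr_minus)
      then have "(D * h k) powr R * 2 powr (- real_of_int k) * (2 powr (k + 1) - 2 powr k) = (D * h k) powr R"
        by (simp add: mult.assoc)
      finally show "(\<integral>\<^sup>+s. ennreal ((D * h k) powr R * 2 powr (- real_of_int k)) * indicator (I k) s \<partial>lborel) = ennreal ((D * h k) powr R)" .
    qed
    also have "\<dots> \<le> ennreal ((D * M) powr R)"
    proof (rule nn_integral_int_le)
      fix F :: "int set" assume F: "finite F"
      have "seq_norm_le r (\<lambda>k. D * h k) (D * M)" using D h by (intro seq_norm_le_scale) auto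
      then show "(\<Sum>k\<in>F. ennreal ((D * h k) powr R)) \<le> ennreal ((D * M) powr R)"
        using F False by (simp add: seq_norm_le_def R_def ennreal_leI)
    qed
    finally show ?thesis
      using False D R h(3) epow_inverse_le_iff[of R "D * M"] by (simp add: lorentz_norm_def R_def D_def)
  qed
qed

section \<open>Uniqueness of representing functions\<close>

lemma iter_pderiv_scaled_of_real:
  fixes \<phi> :: "real^'n \<Rightarrow> real"
  assumes "smooth \<phi>"
  shows "iter_pderiv is (\<lambda>x. complex_of_real (\<phi> (c *\<^sub>R (x - a)))) =
    (\<lambda>x. complex_of_real (c ^ length is * iter_pderiv is \<phi> (c *\<^sub>R (x - a))))"
proof (induction "is")
  case (Cons i "is")
  show ?case
  proof
    fix x
    let ?D = "iter_pderiv is \<phi>" and ?D' = "frechet_derivative (iter_pderiv is \<phi>) (at (c *\<^sub>R (x - a)))"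
    have "(?D has_derivative ?D') (at (c *\<^sub>R (x - a)))"
      using assms by (simp add: smooth_def frechet_derivative_works)
    then have "((\<lambda>x. ?D (c *\<^sub>R (x - a))) has_derivative (\<lambda>h. ?D' (c *\<^sub>R h))) (at x)"
      by (rule has_derivative_compose[rotated]) (auto intro!: derivative_eq_intros)
    then have "((\<lambda>x. complex_of_real (c ^ length is * ?D (c *\<^sub>R (x - a)))) has_derivative
        (\<lambda>h. complex_of_real (c ^ length is * ?D' (c *\<^sub>R h)))) (at x)"
      by (intro has_derivative_of_real has_derivative_mult_right)
    moreover have "?D' (c *\<^sub>R axis i 1) = c * ?D' (axis i 1)"
      using assms by (simp add: smooth_def linear_frechet_derivative linear_cmul)
    ultimately show "iter_pderiv (i # is) (\<lambda>x. complex_of_real (\<phi> (c *\<^sub>R (x - a)))) x =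
        complex_of_real (c ^ length (i # is) * iter_pderiv (i # is) \<phi> (c *\<^sub>R (x - a)))"
      by (simp only: iter_pderiv.simps Cons frechet_derivative_at[symmetric])
         (simp add: frechet_derivative_at[symmetric])
  qed
qed auto

text \<open>The strict inequality describes an open set, so vanishing there passes to each further
  derivative.\<close>

lemma iter_pderiv_eq_0_outside:
  fixes \<phi> :: "real^'n \<Rightarrow> real"
  assumes "\<And>\<xi>. norm \<xi> \<ge> 1 \<Longrightarrow> \<phi> \<xi> = 0" "norm x > 1"
  shows "iter_pderiv is \<phi> x = 0"
  using assms(2)
proof (induction "is" arbitrary: x)
  case (Cons i "is")
  have "open {x::real^'n. norm x > 1}" by (intro open_Collect_less continuous_intros)
  then have "(iter_pderiv is \<phi> has_derivative (\<lambda>_. 0)) (at x)"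
    by (rule has_derivative_transform_within_open[OF has_derivative_const[of 0]])
       (use Cons in auto)
  then show ?case
    by (simp add: frechet_derivative_at[symmetric])
qed (use assms(1) in auto)

lemma smooth_continuous_on: "smooth f \<Longrightarrow> continuous_on S (iter_pderiv is f)"
  by (auto simp: smooth_def intro!: differentiable_imp_continuous_on differentiable_at_imp_differentiable_on)

text \<open>Outside the closed ball of radius 1/c about a all derivatives vanish; on this compact
  ball continuity bounds them together with the polynomial weight. Uniqueness of representing
  functions is tested on these functions only.\<close>

lemma lp_cutoff_scaled_in_schwartz:
  fixes \<phi> :: "real^'n \<Rightarrow> real"
  assumes "lp_cutoff \<phi>" "c > 0"
  shows "(\<lambda>x. complex_of_real (\<phi> (c *\<^sub>R (x - a)))) \<in> schwartz_space"
proof -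
  have sm: "smooth \<phi>" and z: "\<And>\<xi>. norm \<xi> \<ge> 1 \<Longrightarrow> \<phi> \<xi> = 0"
    using assms(1) by (auto simp: lp_cutoff_def)
  let ?g = "\<lambda>x. complex_of_real (\<phi> (c *\<^sub>R (x - a)))"
  note eq = iter_pderiv_scaled_of_real[OF sm, of _ c a]
  have "smooth ?g"
    unfolding smooth_def
  proof (intro allI)
    fix "is" :: "'n list" and x :: "real^'n"
    have "(\<lambda>x. c *\<^sub>R (x - a)) differentiable (at x)" by simp
    then have "(\<lambda>x. iter_pderiv is \<phi> (c *\<^sub>R (x - a))) differentiable (at x)"
      using sm differentiable_compose[of "iter_pderiv is \<phi>" "\<lambda>x. c *\<^sub>R (x - a)"] unfolding smooth_def by blast
    then obtain D where "((\<lambda>x. iter_pderiv is \<phi> (c *\<^sub>R (x - a))) has_derivative D) (at x)"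
      by (auto simp: differentiable_def)
    then have "((\<lambda>x. complex_of_real (c ^ length is * iter_pderiv is \<phi> (c *\<^sub>R (x - a)))) has_derivative
        (\<lambda>h. complex_of_real (c ^ length is * D h))) (at x)"
      by (intro has_derivative_of_real has_derivative_mult_right)
    then show "iter_pderiv is ?g differentiable (at x)"
      unfolding eq by (rule differentiableI)
  qed
  moreover have "bounded (range (\<lambda>x. (1 + norm x) ^ k *\<^sub>R iter_pderiv is ?g x))" for k "is"
  proof -
    let ?P = "\<lambda>x. (1 + norm x) ^ k *\<^sub>R iter_pderiv is ?g x"
    have "continuous_on UNIV ?P"
      by (intro continuous_intros smooth_continuous_on \<open>smooth ?g\<close>)
    then have cpt: "compact (?P ` cball a (1 / c))"
      by (intro compact_continuous_image) (auto intro: continuous_on_subset)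
    have "?P x = 0" if "x \<notin> cball a (1 / c)" for x
    proof -
      have "norm (c *\<^sub>R (x - a)) > 1"
        using that assms(2) by (simp add: not_le dist_norm norm_minus_commute[of a] divide_less_eq mult.commute del: scaleR_right_diff_distrib)
      then have "iter_pderiv is \<phi> (c *\<^sub>R (x - a)) = 0"
        by (intro iter_pderiv_eq_0_outside z)
      then show ?thesis unfolding eq by simp
    qed
    then have sub: "range ?P \<subseteq> insert 0 (?P ` cball a (1 / c))" by blast
    have "bounded (?P ` cball a (1 / c))"
      by (rule compact_imp_bounded[OF cpt])
    then have "bounded (insert 0 (?P ` cball a (1 / c)))" by (simp only: bounded_insert)
    then show ?thesis by (rule bounded_subset) (rule sub)
  qed
  ultimately show ?thesis by (simp add: schwartz_space_def)
qed

section \<open>Decay and integrability of Schwartz functions\<close>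

lemma schwartz_continuous: "f \<in> schwartz_space \<Longrightarrow> continuous_on UNIV f"
  using smooth_continuous_on[of f UNIV "[]"] by (auto simp: schwartz_space_def)

lemma schwartz_measurable: "f \<in> schwartz_space \<Longrightarrow> f \<in> borel_measurable lebesgue"
  by (intro measurable_completion) (simp add: borel_measurable_continuous_onI schwartz_continuous)

lemma schwartz_bound:
  assumes "f \<in> schwartz_space"
  shows "\<exists>K\<ge>0. \<forall>x. (1 + norm x) ^ k * norm (f x) \<le> K"
proof -
  have "bounded (range (\<lambda>x. (1 + norm x) ^ k *\<^sub>R iter_pderiv [] f x))"
    using assms unfolding schwartz_space_def by blast
  then obtain K where K: "\<And>x. norm ((1 + norm x) ^ k *\<^sub>R f x) \<le> K"
    by (auto simp: bounded_iff)
  then have "K \<ge> 0" using norm_ge_zero order_trans by blast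
  with K show ?thesis by (auto intro!: exI[of _ K])
qed

text \<open>The shell m \<le> |x| < m + 1 lies in a ball whose volume is a multiple of (m + 1)^n, so
  the exponent n + 2 leaves the convergent series of 1 / (m + 1)^2.\<close>

lemma nn_integral_decay_finite:
  "(\<integral>\<^sup>+x. ennreal (1 / (1 + norm (x::real^'n)) ^ (CARD('n) + 2)) \<partial>lebesgue) < \<infinity>"
proof -
  let ?n = "CARD('n)"
  let ?V = "emeasure lebesgue (ball (0::real^'n) 1)"
  have pt: "ennreal (1 / (1 + norm x) ^ (?n + 2)) \<le>
      (\<Sum>m. ennreal (1 / (1 + real m) ^ (?n + 2)) * indicator (ball 0 (real m + 1)) x)" for x :: "real^'n"
  proof -
    define m where "m = nat \<lfloor>norm x\<rfloor>"
    have m: "real m \<le> norm x" "norm x < real m + 1" unfolding m_def by auto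
    have "1 / (1 + norm x) ^ (?n + 2) \<le> 1 / (1 + real m) ^ (?n + 2)"
      using m by (intro divide_left_mono power_mono mult_pos_pos zero_less_power) auto
    then have "ennreal (1 / (1 + norm x) ^ (?n + 2)) \<le>
        ennreal (1 / (1 + real m) ^ (?n + 2)) * indicator (ball 0 (real m + 1)) x"
      using m by (auto simp: ennreal_leI)
    also have "\<dots> = sum (\<lambda>m. ennreal (1 / (1 + real m) ^ (?n + 2)) * indicator (ball 0 (real m + 1)) x) {m}"
      by (simp only: sum.insert sum.empty finite.emptyI empty_iff not_False_eq_True add_0_right)
    also have "\<dots> \<le> (\<Sum>m. ennreal (1 / (1 + real m) ^ (?n + 2)) * indicator (ball 0 (real m + 1)) x)"
      by (rule sum_le_suminf) auto
    finally show ?thesis .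
  qed
  have "(\<integral>\<^sup>+x. ennreal (1 / (1 + norm (x::real^'n)) ^ (?n + 2)) \<partial>lebesgue) \<le>
      (\<integral>\<^sup>+x. (\<Sum>m. ennreal (1 / (1 + real m) ^ (?n + 2)) * indicator (ball (0::real^'n) (real m + 1)) x) \<partial>lebesgue)"
    by (intro nn_integral_mono pt)
  also have "\<dots> = (\<Sum>m. ennreal (1 / (1 + real m) ^ (?n + 2)) * emeasure lebesgue (ball (0::real^'n) (real m + 1)))"
    by (subst nn_integral_suminf)
       (auto simp: nn_integral_cmult_indicator intro!: measurable_completion borel_measurable_times_ennreal borel_measurable_indicator)
  also have "\<dots> = (\<Sum>m. ennreal (1 / (1 + real m) ^ 2) * ?V)"
  proof (intro suminf_cong)
    fix m :: nat
    have "1 / z ^ (?n + 2) * z ^ ?n = 1 / z ^ 2" if "z > 0" for z :: real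
      using that by (simp add: power_add power2_eq_square)
    from this[of "1 + real m"] have "1 / (1 + real m) ^ (?n + 2) * (real m + 1) ^ ?n = 1 / (1 + real m) ^ 2"
      by (simp only: add.commute)
    then have "ennreal (1 / (1 + real m) ^ (?n + 2)) * ennreal ((real m + 1) ^ ?n) = ennreal (1 / (1 + real m) ^ 2)"
      by (simp flip: ennreal_mult)
    then show "ennreal (1 / (1 + real m) ^ (?n + 2)) * emeasure lebesgue (ball (0::real^'n) (real m + 1))
        = ennreal (1 / (1 + real m) ^ 2) * ?V"
      by (subst emeasure_lebesgue_ball_conv_unit_ball) (simp_all only: mult.assoc[symmetric] DIM_cart DIM_real mult_1_right of_nat_0_le_iff add_nonneg_nonneg zero_le_one)
  qed
  also have "\<dots> = (\<Sum>m. ennreal (1 / (1 + real m) ^ 2)) * ?V"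
    by (simp add: ennreal_suminf_multc)
  also have "\<dots> < \<infinity>"
  proof -
    have "summable (\<lambda>m. inverse (of_nat m ^ 2 :: real))" by (rule inverse_power_summable) simp
    then have "summable (\<lambda>m. 1 / (1 + real m) ^ 2)"
      by (subst (asm) summable_Suc_iff[symmetric]) (simp add: inverse_eq_divide)
    then have "(\<Sum>m. ennreal (1 / (1 + real m) ^ 2)) = ennreal (\<Sum>m. 1 / (1 + real m) ^ 2)"
      by (intro suminf_ennreal2) auto
    moreover have "?V < \<infinity>" using emeasure_lborel_ball_finite[of "0::real^'n" 1] by simp
    ultimately show ?thesis by (simp add: ennreal_mult_less_top)
  qed
  finally show ?thesis .
qed

lemma schwartz_integrable:
  fixes f :: "real^'n \<Rightarrow> complex"
  assumes "f \<in> schwartz_space"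
  shows "integrable lebesgue f"
proof -
  obtain K where K: "K \<ge> 0" "\<And>x. (1 + norm x) ^ (CARD('n) + 2) * norm (f x) \<le> K"
    using schwartz_bound[OF assms] by blast
  have "(\<integral>\<^sup>+x. ennreal (norm (f x)) \<partial>lebesgue) \<le>
     (\<integral>\<^sup>+x. ennreal K * ennreal (1 / (1 + norm (x::real^'n)) ^ (CARD('n) + 2)) \<partial>lebesgue)"
  proof (intro nn_integral_mono)
    fix x :: "real^'n"
    have "(1 + norm x) ^ (CARD('n) + 2) > 0" by (intro zero_less_power) (auto intro: add_pos_nonneg)
    then have "norm (f x) \<le> K * (1 / (1 + norm x) ^ (CARD('n) + 2))"
      using K(2)[of x] by (simp add: field_simps)
    then show "ennreal (norm (f x)) \<le> ennreal K * ennreal (1 / (1 + norm x) ^ (CARD('n) + 2))"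
      using K(1) by (simp add: ennreal_leI flip: ennreal_mult)
  qed
  also have "\<dots> = ennreal K * (\<integral>\<^sup>+x. ennreal (1 / (1 + norm (x::real^'n)) ^ (CARD('n) + 2)) \<partial>lebesgue)"
    by (intro nn_integral_cmult) (auto intro!: measurable_completion)
  also have "\<dots> < \<infinity>"
    using nn_integral_decay_finite[where 'n='n] by (simp add: ennreal_mult_less_top)
  finally show ?thesis
    using schwartz_measurable[OF assms] by (intro integrableI_bounded)
qed

section \<open>From vanishing test integrals to vanishing almost everywhere\<close>

lemma lborel_integral_affine_vec:
  fixes f :: "real^'n \<Rightarrow> real"
  assumes [measurable]: "f \<in> borel_measurable borel" and c: "c \<noteq> 0"
  shows "(\<integral>x. f x \<partial>lborel) = \<bar>c\<bar> ^ CARD('n) * (\<integral>v. f (t + c *\<^sub>R v) \<partial>lborel)"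
proof -
  have T: "(\<lambda>x::real^'n. t + (\<Sum>j\<in>Basis. (c * (x \<bullet> j)) *\<^sub>R j)) = (\<lambda>x. t + c *\<^sub>R x)"
    by (simp only: scaleR_scaleR[symmetric] scaleR_sum_right[symmetric] euclidean_representation)
  have "lborel = density (distr lborel borel (\<lambda>x::real^'n. t + c *\<^sub>R x)) (\<lambda>_. ennreal (\<bar>c\<bar> ^ CARD('n)))"
    using lborel_affine_euclidean[of "\<lambda>_. c" t] c by (simp add: T)
  then have "(\<integral>x. f x \<partial>lborel) = (\<integral>x. f x \<partial>density (distr lborel borel (\<lambda>x::real^'n. t + c *\<^sub>R x)) (\<lambda>_. ennreal (\<bar>c\<bar> ^ CARD('n))))"
    by simp
  also have "\<dots> = \<bar>c\<bar> ^ CARD('n) * (\<integral>v. f (t + c *\<^sub>R v) \<partial>lborel)"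
    by (simp add: integral_density integral_distr)
  finally show ?thesis .
qed

lemma integrable_bounded_support:
  fixes \<eta> :: "real^'n \<Rightarrow> real"
  assumes [measurable]: "\<eta> \<in> borel_measurable borel"
    and "\<And>x. \<bar>\<eta> x\<bar> \<le> K" "\<And>x. norm x \<ge> 1 \<Longrightarrow> \<eta> x = 0"
  shows "integrable lborel \<eta>"
proof (rule Bochner_Integration.integrable_bound)
  show "integrable lborel (\<lambda>x::real^'n. K * indicator (ball 0 1) x)"
    using emeasure_lborel_ball_finite[of "0::real^'n" 1]
    by (intro integrable_mult_right integrable_real_indicator) auto
  have "K \<ge> 0" using assms(2)[of 0] by linarith
  then show "AE x in lborel. norm (\<eta> x) \<le> norm (K * indicator (ball 0 1) x)"
    using assms(2,3) by (intro AE_I2) (auto simp: indicator_def not_less)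
qed simp

text \<open>Integrating the hypothesis over \<open>a\<close> in the box and applying Fubini tests \<open>G\<close> against the mollified
  indicator of the box, which tends to the indicator off the null frontier.\<close>
lemma box_integral_eq_0_if_orthogonal:
  fixes G \<eta> :: "real^'n \<Rightarrow> real"
  assumes [measurable]: "G \<in> borel_measurable borel" "\<eta> \<in> borel_measurable borel"
    and loc: "\<And>R. integrable lborel (\<lambda>x. indicator (ball 0 R) x * G x)"
    and \<eta>: "\<And>x. \<bar>\<eta> x\<bar> \<le> K" "\<And>x. norm x \<ge> 1 \<Longrightarrow> \<eta> x = 0" "(\<integral>x. \<eta> x \<partial>lborel) \<noteq> 0"
    and orth: "\<And>a c. c > 0 \<Longrightarrow> (\<integral>x. G x * \<eta> (c *\<^sub>R (x - a)) \<partial>lborel) = 0"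
  shows "(\<integral>x. indicator (box l u) x * G x \<partial>lborel) = 0"
proof -
  define B where "B = box l u"
  have [measurable]: "B \<in> sets borel" by (simp add: B_def)
  obtain R where R: "R > 0" "B \<subseteq> ball 0 R"
    unfolding B_def using bounded_subset_ballD[OF bounded_box] by blast
  have [measurable]: "ball (0::real^'n) (R + 1) \<in> sets borel" by simp
  have K: "K \<ge> 0" using \<eta>(1)[of 0] by linarith
  note int\<eta> = integrable_bounded_support[OF assms(2) \<eta>(1,2)]
  define c where "c m = real (Suc m)" for m
  have c: "c m \<ge> 1" for m by (simp add: c_def)
  \<comment> \<open>The indicator of the box convolved with the function x \<mapsto> c^n \<eta>(c
    x), where c = c m.\<close>
  define J where "J m x = (\<integral>v. indicator B (x + (- 1 / c m) *\<^sub>R v) * \<eta> v \<partial>lborel)" for m x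
  define I where "I = (\<integral>x. \<eta> x \<partial>lborel)"
  \<comment> \<open>Since c m \<ge> 1, mollification moves points by at most 1. Hence every
    \<open>J m\<close> vanishes outside the ball of radius R + 1, and one dominating function serves
    all m.\<close>
  have far: "indicator B (x + (- 1 / c m) *\<^sub>R v) * \<eta> v = 0" if "x \<notin> ball 0 (R + 1)" for x m v
  proof (rule ccontr)
    assume nz: "\<not> ?thesis"
    then have "norm v < 1" "x + (- 1 / c m) *\<^sub>R v \<in> B"
      using \<eta>(2)[of v] by (auto simp: indicator_def split: if_splits) (metis not_le)
    then have "norm (x + (- 1 / c m) *\<^sub>R v) < R" using R by auto
    moreover have "norm ((- 1 / c m) *\<^sub>R v) \<le> 1"
      using c[of m] \<open>norm v < 1\<close> by (simp add: divide_le_eq)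
    moreover have "norm x \<le> norm (x + (- 1 / c m) *\<^sub>R v) + norm ((- 1 / c m) *\<^sub>R v)"
      using norm_triangle_ineq4[of "x + (- 1 / c m) *\<^sub>R v" "(- 1 / c m) *\<^sub>R v"] by simp
    ultimately show False using that by simp
  qed
  have GJ: "(\<integral>x. G x * J m x \<partial>lborel) = 0" for m
  proof -
    \<comment> \<open>Fubini's theorem needs integrability on the product. The majorant g of F
      separates the variables and involves G only on a bounded ball.\<close>
    define F where "F a x = indicator B a * (G x * \<eta> (c m *\<^sub>R (x - a)))" for a x
    define g where "g a x = indicator B a * (K * \<bar>indicator (ball 0 (R + 1)) x * G x\<bar>)" for a x :: "real^'n"
    have g: "integrable (lborel \<Otimes>\<^sub>M lborel) (case_prod g)"
    proof (rule lborel_pair.Fubini_integrable)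
      have "integrable lborel (\<lambda>a. indicator B a * (\<integral>x. K * \<bar>indicator (ball 0 (R + 1)) x * G x\<bar> \<partial>lborel))"
        using emeasure_bounded_finite[of B] by (intro integrable_mult_left integrable_real_indicator) (auto simp: B_def)
      moreover have "(\<integral>x. norm (case (a, x) of (a, x) \<Rightarrow> g a x) \<partial>lborel) =
          indicator B a * (\<integral>x. K * \<bar>indicator (ball 0 (R + 1)) x * G x\<bar> \<partial>lborel)" for a
        using K by (auto simp: g_def abs_mult indicator_def)
      ultimately show "integrable lborel (\<lambda>a. \<integral>x. norm (case (a, x) of (a, x) \<Rightarrow> g a x) \<partial>lborel)"
        by simp
      show "AE a in lborel. integrable lborel (\<lambda>x. case (a, x) of (a, x) \<Rightarrow> g a x)"
        unfolding g_def prod.case using loc[of "R + 1"] by (intro AE_I2 integrable_mult_right integrable_abs)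
      show "case_prod g \<in> borel_measurable (lborel \<Otimes>\<^sub>M lborel)"
        unfolding g_def by measurable
    qed
    have "integrable (lborel \<Otimes>\<^sub>M lborel) (case_prod F)"
    proof (rule Bochner_Integration.integrable_bound[OF g])
      have "norm (F a x) \<le> norm (g a x)" for a x
      proof (cases "a \<in> B \<and> norm (c m *\<^sub>R (x - a)) < 1")
        case True
        then have "c m * norm (x - a) < 1" using c[of m] by simp
        moreover have "1 * norm (x - a) \<le> c m * norm (x - a)" using c[of m] by (intro mult_right_mono) auto
        ultimately have "norm (x - a) < 1" by simp
        moreover have "norm a < R" using True R by auto
        ultimately have "norm x < R + 1" using norm_triangle_ineq[of "x - a" a] by simp
        then show ?thesis
          using \<eta>(1)[of "c m *\<^sub>R (x - a)"] K True mult_left_mono[of "\<bar>\<eta> (c m *\<^sub>R (x - a))\<bar>" K "\<bar>G x\<bar>"]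
          by (simp add: F_def g_def abs_mult mult.commute)
      next
        case False
        then have "F a x = 0" using \<eta>(2)[of "c m *\<^sub>R (x - a)"] unfolding F_def by (auto simp: indicator_def not_less)
        then show ?thesis by simp
      qed
      then show "AE x in lborel \<Otimes>\<^sub>M lborel. norm (case_prod F x) \<le> norm (case_prod g x)"
        by (intro AE_I2) (auto split: prod.split)
    qed (simp add: F_def[abs_def])
    from lborel_pair.Fubini_integral[OF this]
    have "(\<integral>x. (\<integral>a. F a x \<partial>lborel) \<partial>lborel) = (\<integral>a. (\<integral>x. F a x \<partial>lborel) \<partial>lborel)" .
    moreover have "(\<integral>x. F a x \<partial>lborel) = 0" for a
      using orth[of "c m" a] c[of m] by (simp add: F_def)
    ultimately have "(\<integral>x. (\<integral>a. F a x \<partial>lborel) \<partial>lborel) = 0" by simp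
    moreover have "(\<integral>a. F a x \<partial>lborel) = \<bar>- 1 / c m\<bar> ^ CARD('n) * (G x * J m x)" for x
    proof -
      have "(\<integral>a. F a x \<partial>lborel) = G x * (\<integral>a. indicator B a * \<eta> (c m *\<^sub>R (x - a)) \<partial>lborel)"
        by (simp add: F_def mult_ac flip: integral_mult_right_zero)
      \<comment> \<open>The substitution a = x - v / c m, which turns the argument of \<eta> into v.
        Its factor is negative, hence the absolute value in the Jacobian.\<close>
      also have "(\<integral>a. indicator B a * \<eta> (c m *\<^sub>R (x - a)) \<partial>lborel) =
          \<bar>- 1 / c m\<bar> ^ CARD('n) * (\<integral>v. indicator B (x + (- 1 / c m) *\<^sub>R v) * \<eta> (c m *\<^sub>R (x - (x + (- 1 / c m) *\<^sub>R v))) \<partial>lborel)"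
        using c[of m] by (intro lborel_integral_affine_vec) auto
      also have "\<dots> = \<bar>- 1 / c m\<bar> ^ CARD('n) * J m x"
        using c[of m] by (simp add: J_def)
      finally show ?thesis by simp
    qed
    ultimately have "\<bar>- 1 / c m\<bar> ^ CARD('n) * (\<integral>x. G x * J m x \<partial>lborel) = 0"
      by (simp flip: integral_mult_right_zero)
    then show ?thesis using c[of m] by simp
  qed
  \<comment> \<open>Off the frontier the indicator of the box is locally constant, so for each v the
    integrand eventually equals its limit.\<close>
  have Jlim: "(\<lambda>m. J m x) \<longlonglongrightarrow> indicator B x * I" if "x \<notin> cbox l u - box l u" for x
  proof -
    have "(\<lambda>m. J m x) \<longlonglongrightarrow> (\<integral>v. indicator B x * \<eta> v \<partial>lborel)"
      unfolding J_def
    proof (rule integral_dominated_convergence[where w="\<lambda>v. \<bar>\<eta> v\<bar>"])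
      show "AE v in lborel. (\<lambda>m. indicator B (x + (- 1 / c m) *\<^sub>R v) * \<eta> v) \<longlonglongrightarrow> indicator B x * \<eta> v"
      proof (intro AE_I2 tendsto_mult_right)
        fix v
        have "(\<lambda>m. - 1 / c m) \<longlonglongrightarrow> 0"
          using tendsto_minus[OF LIMSEQ_inverse_real_of_nat] by (simp add: c_def inverse_eq_divide)
        then have "(\<lambda>m. x + (- 1 / c m) *\<^sub>R v) \<longlonglongrightarrow> x + 0 *\<^sub>R v"
          by (intro tendsto_intros)
        then have lim: "(\<lambda>m. x + (- 1 / c m) *\<^sub>R v) \<longlonglongrightarrow> x" by simp
        have "\<forall>\<^sub>F m in sequentially. indicator B (x + (- 1 / c m) *\<^sub>R v) = (indicator B x :: real)"
        proof (cases "x \<in> B")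
          case True
          then have "\<forall>\<^sub>F m in sequentially. x + (- 1 / c m) *\<^sub>R v \<in> B"
            using lim topological_tendstoD[OF lim, of B] by (auto simp: B_def open_box)
          then show ?thesis by eventually_elim (use True in simp)
        next
          case False
          then have "x \<in> - cbox l u" using that by (auto simp: B_def)
          then have "\<forall>\<^sub>F m in sequentially. x + (- 1 / c m) *\<^sub>R v \<in> - cbox l u"
            using topological_tendstoD[OF lim, of "- cbox l u"] closed_cbox[of l u] by (auto simp: open_Compl)
          then show ?thesis
          proof eventually_elim
            case (elim m)
            then show ?case using False box_subset_cbox[of l u] by (auto simp: B_def indicator_def)
          qed
        qed
        then show "(\<lambda>m. indicator B (x + (- 1 / c m) *\<^sub>R v)) \<longlonglongrightarrow> (indicator B x :: real)"
          by (rule tendsto_eventually)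
      qed
      show "integrable lborel (\<lambda>v. \<bar>\<eta> v\<bar>)" using int\<eta> by (rule integrable_abs)
    qed (auto simp: indicator_def)
    then show ?thesis by (simp add: I_def)
  qed
  have [measurable]: "J m \<in> borel_measurable borel" for m
    unfolding J_def by measurable
  have "(\<lambda>m. \<integral>x. G x * J m x \<partial>lborel) \<longlonglongrightarrow> (\<integral>x. G x * (indicator B x * I) \<partial>lborel)"
  proof (rule integral_dominated_convergence[where w="\<lambda>x. (\<integral>v. \<bar>\<eta> v\<bar> \<partial>lborel) * \<bar>indicator (ball 0 (R + 1)) x * G x\<bar>"])
    have "AE x in lborel. x \<notin> cbox l u - box l u"
      using negligible_frontier_interval[of l u]
      by (intro AE_not_in) (simp add: negligible_iff_null_sets null_sets_completion_iff)
    then show "AE x in lborel. (\<lambda>m. G x * J m x) \<longlonglongrightarrow> G x * (indicator B x * I)"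
      by eventually_elim (intro tendsto_mult_left Jlim)
    show "AE x in lborel. norm (G x * J m x) \<le> (\<integral>v. \<bar>\<eta> v\<bar> \<partial>lborel) * \<bar>indicator (ball 0 (R + 1)) x * G x\<bar>" for m
    proof (intro AE_I2)
      fix x
      show "norm (G x * J m x) \<le> (\<integral>v. \<bar>\<eta> v\<bar> \<partial>lborel) * \<bar>indicator (ball 0 (R + 1)) x * G x\<bar>"
      proof (cases "x \<in> ball 0 (R + 1)")
        case True
        have "\<bar>J m x\<bar> \<le> (\<integral>v. \<bar>\<eta> v\<bar> \<partial>lborel)"
          unfolding J_def
        proof (rule order_trans[OF integral_abs_bound integral_mono_AE])
          show "integrable lborel (\<lambda>v. \<bar>\<eta> v\<bar>)" using int\<eta> by (rule integrable_abs)
          show "integrable lborel (\<lambda>v. \<bar>indicator B (x + (- 1 / c m) *\<^sub>R v) * \<eta> v\<bar>)"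
            by (rule Bochner_Integration.integrable_bound[OF int\<eta>]) (auto simp: indicator_def)
        qed (auto simp: indicator_def)
        then have "\<bar>G x\<bar> * \<bar>J m x\<bar> \<le> \<bar>G x\<bar> * (\<integral>v. \<bar>\<eta> v\<bar> \<partial>lborel)"
          by (intro mult_left_mono) auto
        with True show ?thesis by (simp add: abs_mult mult.commute)
      next
        case False
        have "J m x = 0" unfolding J_def far[OF False] by simp
        then show ?thesis by simp
      qed
    qed
    show "integrable lborel (\<lambda>x. (\<integral>v. \<bar>\<eta> v\<bar> \<partial>lborel) * \<bar>indicator (ball 0 (R + 1)) x * G x\<bar>)"
      by (intro integrable_mult_right integrable_abs loc)
  qed auto
  then have "(\<integral>x. G x * (indicator B x * I) \<partial>lborel) = 0"
    unfolding GJ by (simp add: LIMSEQ_const_iff)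
  moreover have "(\<integral>x. G x * (indicator B x * I) \<partial>lborel) = I * (\<integral>x. indicator B x * G x \<partial>lborel)"
    by (simp add: mult_ac flip: integral_mult_right_zero)
  ultimately show ?thesis using \<eta>(3) by (simp add: I_def B_def)
qed

text \<open>For an integrable function with total integral 0, the Borel sets over which it
  integrates to 0 form a Dynkin system. Boxes are stable under intersection and generate the Borel
  sets, so the function vanishes almost everywhere. As G is integrable on boxes only, this is
  applied to its restrictions to cubes that exhaust the space.\<close>

lemma AE_zero_if_box_integrals_zero:
  fixes G :: "real^'n \<Rightarrow> real"
  assumes G[measurable]: "G \<in> borel_measurable borel"
    and loc: "\<And>l u. integrable lborel (\<lambda>x. indicator (box l u) x * G x)"
    and box: "\<And>l u. (\<integral>x. indicator (box l u) x * G x \<partial>lborel) = 0"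
  shows "AE x in lborel. G x = 0"
proof -
  define W :: "nat \<Rightarrow> (real^'n) set" where "W N = box (- (real N *\<^sub>R One)) (real N *\<^sub>R One)" for N
  have "AE x in lborel. indicator (W N) x * G x = 0" for N
  proof -
    define H where "H x = indicator (W N) x * G x" for x
    have H: "integrable lborel H" unfolding H_def W_def by (rule loc)
    \<comment> \<open>A box meets the cube in another box, so the hypothesis on G covers the
      restriction H.\<close>
    have Hbox: "(LINT x:box l u|lborel. H x) = 0" for l u
    proof -
      obtain l' u' where "box l u \<inter> W N = box l' u'"
        unfolding W_def using box_Int_box by blast
      then have "indicator (box l u) x *\<^sub>R H x = indicator (box l' u') x * G x" for x
        unfolding H_def by (auto simp: indicator_def set_eq_iff)
      then show ?thesis unfolding set_lebesgue_integral_def using box by simp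
    qed
    have zero: "(LINT x:A|lborel. H x) = 0" if A: "A \<in> sigma_sets UNIV (range (\<lambda>(a, b). box a b))" for A :: "(real^'n) set"
    proof (rule sigma_sets_induct_disjoint[OF _ _ A])
      show "Int_stable (range (\<lambda>(a, b). box a b :: (real^'n) set))"
        by (auto simp: Int_stable_def box_Int_box)
      have sets: "sets borel = sigma_sets UNIV (range (\<lambda>(a, b). box a b :: (real^'n) set))"
        by (subst borel_eq_box) (simp add: sets_measure_of)
      have si: "set_integrable lborel A H" if "A \<in> sets borel" for A
        using H that integrable_mult_indicator[of A lborel H] by (simp add: set_integrable_def)
      have tot: "(LINT x|lborel. H x) = 0"
        unfolding H_def W_def by (rule box)
      show "(LINT x:UNIV - A|lborel. H x) = 0"
        if "A \<in> sigma_sets UNIV (range (\<lambda>(a, b). box a b))" "(LINT x:A|lborel. H x) = 0" for A :: "(real^'n) set"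
      proof -
        have A: "A \<in> sets borel" using that sets by simp
        have "(LINT x:UNIV - A|lborel. H x) = (LINT x|lborel. H x - indicator A x *\<^sub>R H x)"
          unfolding set_lebesgue_integral_def
          by (intro Bochner_Integration.integral_cong) (auto simp: indicator_def)
        also have "\<dots> = (LINT x|lborel. H x) - (LINT x:A|lborel. H x)"
          using H si[OF A] unfolding set_lebesgue_integral_def set_integrable_def
          by (intro Bochner_Integration.integral_diff)
        finally show ?thesis using tot that by simp
      qed
      show "(LINT x:(\<Union>i. A i)|lborel. H x) = 0"
        if "disjoint_family A" "range A \<subseteq> sigma_sets UNIV (range (\<lambda>(a, b). box a b))"
          "\<And>i. (LINT x:A i|lborel. H x) = 0" for A :: "nat \<Rightarrow> (real^'n) set"
      proof -
        have A: "A i \<in> sets borel" for i using that(2) sets by auto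
        have "(LINT x:(\<Union>i. A i)|lborel. H x) = (\<Sum>i. (LINT x:A i|lborel. H x))"
          using A that(1) by (intro lebesgue_integral_countable_add si) (auto simp: disjoint_family_on_def)
        then show ?thesis using that(3) by simp
      qed
    qed (use Hbox in \<open>auto simp: set_lebesgue_integral_def\<close>)
    have "AE x in lborel. H x = 0"
    proof (rule density_unique_real[OF H, of "\<lambda>_. 0"])
      fix A :: "(real^'n) set" assume "A \<in> sets lborel"
      then have "A \<in> sigma_sets UNIV (range (\<lambda>(a, b). box a b))"
        by (subst (asm) sets_lborel, subst (asm) borel_eq_box) (simp add: sets_measure_of)
      from zero[OF this] show "(LINT x:A|lborel. H x) = (LINT x:A|lborel. 0)"
        by (simp add: set_lebesgue_integral_def)
    qed simp
    then show ?thesis by (simp add: H_def)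
  qed
  then have "AE x in lborel. \<forall>N. indicator (W N) x * G x = 0"
    unfolding AE_all_countable by blast
  then show ?thesis
  proof eventually_elim
    case (elim x)
    obtain N where "x \<in> W N"
    proof -
      have "(\<Union>N. W N) = UNIV" unfolding W_def by (rule UN_box_eq_UNIV)
      then show ?thesis using that by blast
    qed
    with elim show ?case by (metis indicator_simps(1) mult_1)
  qed
qed

lemma lp_cutoff_facts:
  fixes \<phi> :: "real^'n \<Rightarrow> real"
  assumes "lp_cutoff \<phi>"
  shows "\<phi> \<in> borel_measurable borel" "\<exists>K. \<forall>x. \<bar>\<phi> x\<bar> \<le> K" "\<And>x. norm x \<ge> 1 \<Longrightarrow> \<phi> x = 0"
    "(\<integral>x. \<phi> x \<partial>lborel) \<noteq> 0"
proof -
  have \<phi>: "smooth \<phi>" "\<And>x. 0 \<le> \<phi> x" "\<And>x. norm x \<le> 1/2 \<Longrightarrow> \<phi> x = 1" "\<And>x. norm x \<ge> 1 \<Longrightarrow> \<phi> x = 0"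
    using assms by (auto simp: lp_cutoff_def)
  have c: "continuous_on UNIV \<phi>" using smooth_continuous_on[OF \<phi>(1), of UNIV "[]"] by simp
  show [measurable]: "\<phi> \<in> borel_measurable borel" using c by (rule borel_measurable_continuous_onI)
  have "compact (\<phi> ` cball 0 1)"
    by (intro compact_continuous_image continuous_on_subset[OF c]) auto
  then obtain K where "\<forall>x\<in>cball 0 1. \<bar>\<phi> x\<bar> \<le> K"
    by (auto simp: bounded_iff dest!: compact_imp_bounded)
  then have K: "\<And>x. norm x \<le> 1 \<Longrightarrow> \<bar>\<phi> x\<bar> \<le> K" by simp
  have "\<bar>\<phi> x\<bar> \<le> K" for x
    using K[of x] K[of 0] \<phi>(4)[of x] by (cases "norm x \<le> 1") auto
  then show bd: "\<exists>K. \<forall>x. \<bar>\<phi> x\<bar> \<le> K" by blast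
  show "\<phi> x = 0" if "norm x \<ge> 1" for x using \<phi>(4)[OF that] .
  have int: "integrable lborel \<phi>"
    using bd \<phi>(4) by (auto intro!: integrable_bounded_support)
  \<comment> \<open>A nonnegative function with integral 0 vanishes almost everywhere, whereas
    \<phi> is 1 on a ball of positive volume.\<close>
  show "(\<integral>x. \<phi> x \<partial>lborel) \<noteq> 0"
  proof
    assume "(\<integral>x. \<phi> x \<partial>lborel) = 0"
    then have "AE x in lborel. \<phi> x = 0"
      using int \<phi>(2) by (simp add: integral_nonneg_eq_0_iff_AE)
    then have "AE x in lborel. x \<notin> ball (0::real^'n) (1/2)"
      by eventually_elim (use \<phi>(3) in auto)
    then have "emeasure lborel (ball (0::real^'n) (1/2)) = 0"
      by (subst (asm) AE_iff_measurable[where N="ball (0::real^'n) (1/2)"]) auto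
    moreover have "measure lborel (ball (0::real^'n) (1/2)) > 0" by (rule content_ball_pos) simp
    ultimately show False by (simp add: measure_def)
  qed
qed

text \<open>The cutoff supplies the test functions: g - h integrates to 0 against every translate
  and dilate of \<phi>. The preceding results for real functions apply to the real and the imaginary
  part, each in the role of P.\<close>

lemma represents_unique:
  fixes \<phi> :: "real^'n \<Rightarrow> real" and g h :: "real^'n \<Rightarrow> complex"
  assumes \<phi>: "lp_cutoff \<phi>" and g: "represents g u" and h: "represents h u"
  shows "AE x in lebesgue. g x = h x"
proof -
  note gm = g[unfolded represents_def] and hm = h[unfolded represents_def]
  obtain K where K: "\<And>x. \<bar>\<phi> x\<bar> \<le> K" using lp_cutoff_facts(2)[OF \<phi>] by blast
  have main: "AE x in lebesgue. P (g x - h x) = 0"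
    if P: "bounded_linear P" and Pmult: "\<And>z r. P (z * complex_of_real r) = P z * r" for P :: "complex \<Rightarrow> real"
  proof -
    have meas: "(\<lambda>x. P (g x - h x)) \<in> borel_measurable lebesgue"
      using gm hm
      by (intro measurable_compose[OF _ borel_measurable_continuous_onI[OF linear_continuous_on[OF P]]] borel_measurable_diff) auto
    \<comment> \<open>A Borel version of the component, since the Fubini and Dynkin arguments are
      carried out for Borel functions.\<close>
    obtain G where G[measurable]: "G \<in> borel_measurable lborel" and AE: "AE x in lborel. P (g x - h x) = G x"
      using completion_ex_borel_measurable_real[OF meas] by auto
    then have AE': "AE x in lebesgue. P (g x - h x) = G x"
      by (rule_tac AE_completion)
    let ?s = "\<lambda>a c x. complex_of_real (\<phi> (c *\<^sub>R (x - a)))"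
    have [measurable]: "\<phi> \<in> borel_measurable borel" using lp_cutoff_facts[OF \<phi>] by simp
    have int: "integrable lborel (\<lambda>x. G x * \<phi> (c *\<^sub>R (x - a)))"
      and zero: "(\<integral>x. G x * \<phi> (c *\<^sub>R (x - a)) \<partial>lborel) = 0" if "c > 0" for a c
    proof -
      have s: "?s a c \<in> schwartz_space" by (rule lp_cutoff_scaled_in_schwartz[OF \<phi> that])
      have ig: "integrable lebesgue (\<lambda>x. g x * ?s a c x)" and ih: "integrable lebesgue (\<lambda>x. h x * ?s a c x)"
        and eq: "(LINT x|lebesgue. g x * ?s a c x) = (LINT x|lebesgue. h x * ?s a c x)"
        using gm hm s by auto
      have "integrable lebesgue (\<lambda>x. P (g x * ?s a c x - h x * ?s a c x))"
        by (intro integrable_bounded_linear[OF P] Bochner_Integration.integrable_diff ig ih)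
      moreover have Peq: "P (g x * ?s a c x - h x * ?s a c x) = P (g x - h x) * \<phi> (c *\<^sub>R (x - a))" for x
        using Pmult[of "g x - h x" "\<phi> (c *\<^sub>R (x - a))"] by (simp add: left_diff_distrib)
      ultimately have i1: "integrable lebesgue (\<lambda>x. P (g x - h x) * \<phi> (c *\<^sub>R (x - a)))" by simp
      have AE2: "AE x in lebesgue. P (g x - h x) * \<phi> (c *\<^sub>R (x - a)) = G x * \<phi> (c *\<^sub>R (x - a))"
        using AE' by eventually_elim simp
      have m: "(\<lambda>x. G x * \<phi> (c *\<^sub>R (x - a))) \<in> borel_measurable lebesgue"
        by (intro measurable_completion) measurable
      have "integrable lebesgue (\<lambda>x. G x * \<phi> (c *\<^sub>R (x - a)))"
        using integrable_cong_AE[OF _ m AE2] i1 by (simp add: borel_measurable_integrable)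
      then show "integrable lborel (\<lambda>x. G x * \<phi> (c *\<^sub>R (x - a)))"
        by (subst (asm) integrable_completion) measurable
      have "(LINT x|lebesgue. P (g x - h x) * \<phi> (c *\<^sub>R (x - a))) = P (LINT x|lebesgue. g x * ?s a c x - h x * ?s a c x)"
        by (subst integral_bounded_linear[OF P, symmetric])
           (auto simp: Peq intro!: Bochner_Integration.integrable_diff ig ih)
      also have "(LINT x|lebesgue. g x * ?s a c x - h x * ?s a c x) = 0"
        using eq by (subst Bochner_Integration.integral_diff[OF ig ih]) simp
      also have "P 0 = 0" using P by (simp add: bounded_linear.linear linear_0)
      finally have "(LINT x|lebesgue. G x * \<phi> (c *\<^sub>R (x - a))) = 0"
        using integral_cong_AE[OF borel_measurable_integrable[OF i1] m AE2] by simp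
      then show "(\<integral>x. G x * \<phi> (c *\<^sub>R (x - a)) \<partial>lborel) = 0"
        by (subst (asm) integral_completion) measurable
    qed
    have loc: "integrable lborel (\<lambda>x. indicator (ball 0 R) x * G x)" for R
    proof -
      \<comment> \<open>This dilation makes \<phi> equal to 1 on the ball of radius R, so
        integrability against it gives local integrability. The maximum keeps c positive for every
        R.\<close>
      define c where "c = 1 / (2 * max R 1)"
      have c: "c > 0" by (simp add: c_def)
      show ?thesis
      proof (rule Bochner_Integration.integrable_bound[OF int[OF c, of 0]])
        have "indicator (ball 0 R) x * \<bar>G x\<bar> \<le> \<bar>G x * \<phi> (c *\<^sub>R (x - 0))\<bar>" for x
        proof (cases "norm x < R")
          case True
          then have "norm (c *\<^sub>R (x - 0)) \<le> 1/2" by (simp add: c_def field_simps)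
          then have "\<phi> (c *\<^sub>R (x - 0)) = 1" using \<phi> by (simp add: lp_cutoff_def)
          then show ?thesis using True by simp
        qed simp
        then show "AE x in lborel. norm (indicator (ball 0 R) x * G x) \<le> norm (G x * \<phi> (c *\<^sub>R (x - 0)))"
          by (intro AE_I2) (auto simp: abs_mult)
      qed (intro borel_measurable_times borel_measurable_indicator; use G in simp)
    qed
    have "AE x in lborel. G x = 0"
    proof (rule AE_zero_if_box_integrals_zero)
      show "integrable lborel (\<lambda>x. indicator (box l u) x * G x)" for l u
      proof -
        obtain R where "box l u \<subseteq> ball 0 R"
          using bounded_subset_ballD[OF bounded_box] by blast
        then show ?thesis
          using G by (intro Bochner_Integration.integrable_bound[OF loc[of R]] AE_I2 borel_measurable_times borel_measurable_indicator)
            (auto simp: indicator_def)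
      qed
      show "(\<integral>x. indicator (box l u) x * G x \<partial>lborel) = 0" for l u
        by (rule box_integral_eq_0_if_orthogonal[OF _ _ loc K _ _ zero]) (use lp_cutoff_facts[OF \<phi>] G in auto)
    qed (use G in simp)
    then have "AE x in lebesgue. G x = 0" by (rule AE_completion)
    with AE' show ?thesis by eventually_elim simp
  qed
  have "AE x in lebesgue. Re (g x - h x) = 0" "AE x in lebesgue. Im (g x - h x) = 0"
    by (rule main; auto intro: bounded_linear_Re bounded_linear_Im)+
  then show ?thesis by eventually_elim (auto simp: complex_eq_iff)
qed

section \<open>Besov semi-norms and Lorentz norms\<close>

lemma recip_inject: "q \<ge> 1 \<Longrightarrow> q' \<ge> 1 \<Longrightarrow> recip q = recip q' \<Longrightarrow> q = q'"
  using recip_eq[of q] recip_eq[of q'] recip_eq_0_iff[of q] recip_eq_0_iff[of q']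
    enn2real_ge_1[of q] enn2real_ge_1[of q']
  by (cases q; cases q') auto

lemma Lq_norm_cong_AE:
  fixes g h :: "real^'n \<Rightarrow> complex"
  assumes [measurable]: "g \<in> borel_measurable lebesgue" "h \<in> borel_measurable lebesgue"
    and AE: "AE x in lebesgue. g x = h x"
  shows "Lq_norm q g = Lq_norm q h"
proof -
  have "(\<integral>\<^sup>+x. ennreal (norm (g x)) ^\<^sub>e Q \<partial>lebesgue) = (\<integral>\<^sup>+x. ennreal (norm (h x)) ^\<^sub>e Q \<partial>lebesgue)" for Q
    by (rule nn_integral_cong_AE) (use AE in eventually_elim, simp)
  moreover have "esssup lebesgue (\<lambda>x. ennreal (norm (g x))) = esssup lebesgue (\<lambda>x. ennreal (norm (h x)))"
    by (rule esssup_AE_cong) (simp_all, use AE in eventually_elim, simp)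
  ultimately show ?thesis by (simp add: Lq_norm_def)
qed

lemma represents_measurable: "represents g u \<Longrightarrow> g \<in> borel_measurable lebesgue"
  and represents_integrable: "represents g u \<Longrightarrow> f \<in> schwartz_space \<Longrightarrow> integrable lebesgue (\<lambda>x. g x * f x)"
  and represents_eq: "represents g u \<Longrightarrow> f \<in> schwartz_space \<Longrightarrow> u f = (LINT x|lebesgue. g x * f x)"
  unfolding represents_def by blast+

text \<open>By uniqueness the infimum runs over a single value.\<close>

lemma dLq_norm_eq:
  fixes \<phi> :: "real^'n \<Rightarrow> real" and g :: "real^'n \<Rightarrow> complex"
  assumes \<phi>: "lp_cutoff \<phi>" and g: "represents g u"
  shows "dLq_norm q u = Lq_norm q g"
proof -
  have "Lq_norm q h = Lq_norm q g" if "represents h u" for h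
    by (rule Lq_norm_cong_AE[OF _ _ represents_unique[OF \<phi> that g]])
       (rule represents_measurable[OF that] represents_measurable[OF g])+
  then have "{Lq_norm q h | h. represents h u} = {Lq_norm q g}" using g by blast
  then show ?thesis by (simp add: dLq_norm_def)
qed

text \<open>The infimum of the empty set is \<infinity>.\<close>

lemma dLq_norm_finite_imp_represents:
  assumes "dLq_norm q u < \<infinity>"
  shows "\<exists>g. represents g u"
proof (rule ccontr)
  assume "\<nexists>g. represents g u"
  then have "{Lq_norm q g | g. represents g u} = {}" by blast
  with assms show False by (simp add: dLq_norm_def)
qed

text \<open>Passage from \<open>ennreal\<close> to the real sequences of the discrete inequality.
  All weights are positive, so finiteness of the semi-norm forces finiteness for each block.\<close>

lemma besov_seminorm_finite:
  fixes u :: "('n::finite) functional" and \<phi> :: "real^'n \<Rightarrow> real" and s :: real and q r :: ennreal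
  defines "d j \<equiv> dLq_norm q (lp_block \<phi> j u)"
  assumes fin: "besov_seminorm \<phi> s q r u < \<infinity>" and r: "r \<ge> 1"
  shows "d j < \<infinity>"
    and "seq_norm_le r (\<lambda>j. 2 powr (real_of_int j * s) * enn2real (d j)) (enn2real (besov_seminorm \<phi> s q r u))"
proof -
  define N where "N = enn2real (besov_seminorm \<phi> s q r u)"
  have N: "besov_seminorm \<phi> s q r u = ennreal N" "0 \<le> N" using fin by (auto simp: N_def)
  have "(\<forall>j. d j < \<infinity>) \<and> seq_norm_le r (\<lambda>j. 2 powr (real_of_int j * s) * enn2real (d j)) N"
  proof (cases "r = \<infinity>")
    case True
    have le: "ennreal (2 powr (real_of_int j * s)) * d j \<le> ennreal N" for j
      unfolding N(1)[symmetric] using True by (auto simp: besov_seminorm_def d_def intro: SUP_upper)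
    have dfin: "d j < \<infinity>" for j
      using le[of j] by (cases "d j") (auto simp: ennreal_mult_top top_unique)
    moreover have "2 powr (real_of_int j * s) * enn2real (d j) \<le> N" for j
    proof -
      have "enn2real (ennreal (2 powr (real_of_int j * s)) * d j) \<le> enn2real (ennreal N)"
        using le by (intro enn2real_mono) auto
      then show ?thesis using N by (simp add: enn2real_mult)
    qed
    ultimately show ?thesis using True by (simp add: seq_norm_le_def)
  next
    case False
    define R where "R = enn2real r"
    have R: "R \<ge> 1" using enn2real_ge_1[OF False r] by (simp add: R_def)
    let ?t = "\<lambda>j. ennreal (2 powr (real_of_int j * s * R)) * d j ^\<^sub>e R"
    have "(\<Sum>\<^sub>\<infinity>j. ?t j) \<le> ennreal (N powr R)"
      using False N R epow_inverse_le_iff[of R N "\<Sum>\<^sub>\<infinity>j. ?t j"]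
      by (simp add: besov_seminorm_def d_def R_def)
    \<comment> \<open>An infinite sum of nonnegative terms is the supremum of its finite partial
      sums.\<close>
    then have le: "sum ?t F \<le> ennreal (N powr R)" if "finite F" for F
      using that by (subst (asm) nonneg_infsum_complete) (auto simp: SUP_le_iff)
    have dfin: "d j < \<infinity>" for j
      using le[of "{j}"] by (cases "d j") (auto simp: epow_def ennreal_mult_top top_unique)
    have "?t j = ennreal ((2 powr (real_of_int j * s) * enn2real (d j)) powr R)" for j
    proof -
      have "d j = ennreal (enn2real (d j))" using dfin[of j] by simp
      then have "d j ^\<^sub>e R = ennreal (enn2real (d j) powr R)" by (metis enn2real_nonneg epow_ennreal)
      then show ?thesis by (simp add: powr_mult powr_powr ennreal_mult)
    qed
    then have "(\<Sum>j\<in>F. (2 powr (real_of_int j * s) * enn2real (d j)) powr R) \<le> N powr R" if "finite F" for F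
      using le[OF that] by simp
    with dfin show ?thesis using False by (simp add: seq_norm_le_def R_def)
  qed
  then show "d j < \<infinity>" "seq_norm_le r (\<lambda>j. 2 powr (real_of_int j * s) * enn2real (d j)) (enn2real (besov_seminorm \<phi> s q r u))"
    by (auto simp: N_def)
qed

section \<open>Convergence of the sum of the dyadic blocks\<close>

lemma sum_le_nn_integral_int:
  fixes f :: "int \<Rightarrow> ennreal"
  assumes "finite F"
  shows "sum f F \<le> (\<integral>\<^sup>+j. f j \<partial>count_space UNIV)"
proof -
  have "sum f F = (\<integral>\<^sup>+j. f j * indicator F j \<partial>count_space UNIV)"
    using assms by (simp add: nn_integral_count_space_finite flip: nn_integral_count_space_indicator)
  also have "\<dots> \<le> (\<integral>\<^sup>+j. f j \<partial>count_space UNIV)"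
    by (intro nn_integral_mono) (auto simp: indicator_def)
  finally show ?thesis .
qed

text \<open>Absolute summability gives an unordered sum. The intervals from -N to N eventually
  contain every finite set, so the symmetric partial sums have the same limit.\<close>

lemma symmetric_partial_sums_tendsto:
  fixes a :: "int \<Rightarrow> complex"
  assumes "(\<integral>\<^sup>+j. ennreal (norm (a j)) \<partial>count_space UNIV) < \<infinity>"
  shows "(\<lambda>N. \<Sum>j = - int N..int N. a j) \<longlonglongrightarrow> lim (\<lambda>N. \<Sum>j = - int N..int N. a j)"
    and "ennreal (norm (lim (\<lambda>N. \<Sum>j = - int N..int N. a j))) \<le> (\<integral>\<^sup>+j. ennreal (norm (a j)) \<partial>count_space UNIV)"
proof -
  obtain t where t: "(\<integral>\<^sup>+j. ennreal (norm (a j)) \<partial>count_space UNIV) = ennreal t" "0 \<le> t"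
    using assms by (cases "\<integral>\<^sup>+j. ennreal (norm (a j)) \<partial>count_space UNIV") auto
  have le: "(\<Sum>j\<in>F. norm (a j)) \<le> t" if "finite F" for F
    using sum_le_nn_integral_int[OF that, of "\<lambda>j. ennreal (norm (a j))"] t by simp
  have "(\<lambda>j. norm (a j)) summable_on UNIV"
    by (rule nonneg_bdd_above_summable_on) (auto intro!: bdd_aboveI2[of _ _ t] le)
  then have "a summable_on UNIV" by (rule abs_summable_summable)
  then obtain l where "(a has_sum l) UNIV" by (auto simp: summable_on_def)
  then have hs: "(sum a \<longlongrightarrow> l) (finite_subsets_at_top UNIV)" by (simp add: has_sum_def)
  have "filterlim (\<lambda>N. {- int N..int N}) (finite_subsets_at_top UNIV) sequentially"
    unfolding filterlim_finite_subsets_at_top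
  proof (intro allI impI)
    fix F :: "int set" assume F: "finite F \<and> F \<subseteq> UNIV"
    \<comment> \<open>This sum bounds every |j| with j in F and covers the empty set as
      well.\<close>
    define M where "M = (\<Sum>j\<in>F. nat \<bar>j\<bar>)"
    have "nat \<bar>j\<bar> \<le> M" if "j \<in> F" for j unfolding M_def using F that by (intro member_le_sum) auto
    then have sub: "F \<subseteq> {- int N..int N}" if "N \<ge> M" for N using that by (force simp: abs_le_iff)
    show "\<forall>\<^sub>F N in sequentially. finite {- int N..int N} \<and> F \<subseteq> {- int N..int N} \<and> {- int N..int N} \<subseteq> UNIV"
      using eventually_ge_at_top[of M] by eventually_elim (use sub in simp)
  qed
  from filterlim_compose[OF hs this] have l: "(\<lambda>N. \<Sum>j = - int N..int N. a j) \<longlonglongrightarrow> l" .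
  then have lim: "lim (\<lambda>N. \<Sum>j = - int N..int N. a j) = l" by (rule limI)
  show "(\<lambda>N. \<Sum>j = - int N..int N. a j) \<longlonglongrightarrow> lim (\<lambda>N. \<Sum>j = - int N..int N. a j)"
    using l lim by simp
  have "norm l \<le> t"
    using l by (rule Lim_norm_ubound[rotated]) (auto intro!: always_eventually order_trans[OF norm_sum le])
  then show "ennreal (norm (lim (\<lambda>N. \<Sum>j = - int N..int N. a j))) \<le> (\<integral>\<^sup>+j. ennreal (norm (a j)) \<partial>count_space UNIV)"
    using t lim by (simp add: ennreal_leI)
qed

text \<open>The splitting with s = 1 shows that the series of absolute values is finite almost
  everywhere and integrable against Schwartz functions. Dominated convergence then identifies u with
  the pointwise limit of the symmetric partial sums.\<close>

lemma represents_series: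
  fixes g :: "int \<Rightarrow> real^'n \<Rightarrow> complex"
  assumes rep: "\<And>j. represents (g j) (v j)"
    and c: "\<And>j. 0 \<le> c j" "\<And>F. finite F \<Longrightarrow> sum c F \<le> H"
    and ex: "\<And>j. (\<integral>\<^sup>+x. ennreal (max 0 (norm (g j x) - c j)) \<partial>lebesgue) \<le> ennreal (c j)"
    and lim: "\<And>f. f \<in> schwartz_space \<Longrightarrow> (\<lambda>N. \<Sum>j = - int N..int N. v j f) \<longlonglongrightarrow> u f"
  obtains G where "represents G u"
    "AE x in lebesgue. ennreal (norm (G x)) \<le> (\<integral>\<^sup>+j. ennreal (norm (g j x)) \<partial>count_space UNIV)"
proof -
  have g[measurable]: "g j \<in> borel_measurable lebesgue" for j using rep by (rule represents_measurable)
  define T where "T x = (\<integral>\<^sup>+j. ennreal (norm (g j x)) \<partial>count_space UNIV)" for x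
  define G where "G x = lim (\<lambda>N. \<Sum>j = - int N..int N. g j x)" for x
  have [measurable]: "T \<in> borel_measurable lebesgue"
    unfolding T_def by (rule borel_measurable_nn_integral_int) measurable
  have G[measurable]: "G \<in> borel_measurable lebesgue"
    unfolding G_def by measurable
  obtain W where [measurable]: "W \<in> borel_measurable lebesgue"
    and intW: "(\<integral>\<^sup>+x. W x \<partial>lebesgue) \<le> ennreal H" and TW: "\<And>x. T x \<le> ennreal H + W x"
    using sum_norm_le_plus_excess[of g c H 1] g c ex unfolding T_def by (metis mult_1 mult_1_right zero_less_one)
  have "AE x in lebesgue. W x \<noteq> \<infinity>"
    using intW by (intro nn_integral_PInf_AE) (auto simp: top_unique)
  then have Tfin: "AE x in lebesgue. T x < \<infinity>"
  proof eventually_elim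
    case (elim x)
    then have "ennreal H + W x < \<infinity>" by (simp add: less_top)
    then show ?case using TW[of x] by (rule order_le_less_trans[rotated])
  qed
  then have GT: "AE x in lebesgue. ennreal (norm (G x)) \<le> T x"
    by eventually_elim (use symmetric_partial_sums_tendsto(2) in \<open>simp add: T_def G_def\<close>)
  have "represents G u"
    unfolding represents_def
  proof (intro conjI ballI G)
    fix f :: "real^'n \<Rightarrow> complex" assume f: "f \<in> schwartz_space"
    have fm[measurable]: "f \<in> borel_measurable lebesgue" by (rule schwartz_measurable[OF f])
    obtain K where K: "0 \<le> K" "\<And>x. norm (f x) \<le> K" using schwartz_bound[OF f, of 0] by auto
    \<comment> \<open>The majorant. \<open>enn2real\<close> sends \<infinity> to 0, which affects
      only a null set.\<close>
    define w where "w x = enn2real (T x) * norm (f x)" for x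
    have "(\<integral>\<^sup>+x. ennreal (norm (w x)) \<partial>lebesgue) \<le> (\<integral>\<^sup>+x. ennreal H * ennreal (norm (f x)) + ennreal K * W x \<partial>lebesgue)"
    proof (rule nn_integral_mono)
      fix x
      have "ennreal (norm (w x)) \<le> T x * ennreal (norm (f x))"
        by (cases "T x") (auto simp: w_def ennreal_mult)
      also have "\<dots> \<le> (ennreal H + W x) * ennreal (norm (f x))"
        by (intro mult_right_mono TW) auto
      \<comment> \<open>The bounded part is paired with the integrable f, the integrable part W with
        the bound K of |f|.\<close>
      also have "\<dots> \<le> ennreal H * ennreal (norm (f x)) + W x * ennreal K"
        using K(2)[of x] by (simp add: distrib_right add_left_mono mult_left_mono ennreal_leI)
      finally show "ennreal (norm (w x)) \<le> ennreal H * ennreal (norm (f x)) + ennreal K * W x"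
        by (simp add: mult.commute)
    qed
    also have "\<dots> = ennreal H * (\<integral>\<^sup>+x. ennreal (norm (f x)) \<partial>lebesgue) + ennreal K * (\<integral>\<^sup>+x. W x \<partial>lebesgue)"
      by (simp add: nn_integral_add nn_integral_cmult)
    also have "\<dots> < \<infinity>"
      using schwartz_integrable[OF f] intW
      by (auto simp: integrable_iff_bounded ennreal_mult_less_top intro: order_le_less_trans)
    finally have w: "integrable lebesgue w"
      by (intro integrableI_bounded) (simp_all add: w_def[abs_def])
    have dom: "(\<lambda>x. G x * f x) \<in> borel_measurable lebesgue"
      "\<And>N. (\<lambda>x. (\<Sum>j = - int N..int N. g j x) * f x) \<in> borel_measurable lebesgue"
      "AE x in lebesgue. (\<lambda>N. (\<Sum>j = - int N..int N. g j x) * f x) \<longlonglongrightarrow> G x * f x"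
      "\<And>N. AE x in lebesgue. norm ((\<Sum>j = - int N..int N. g j x) * f x) \<le> w x"
    proof -
      show "AE x in lebesgue. (\<lambda>N. (\<Sum>j = - int N..int N. g j x) * f x) \<longlonglongrightarrow> G x * f x"
        using Tfin
        by eventually_elim (use symmetric_partial_sums_tendsto(1) in \<open>auto simp: T_def G_def intro!: tendsto_mult_right\<close>)
      show "AE x in lebesgue. norm ((\<Sum>j = - int N..int N. g j x) * f x) \<le> w x" for N
        using Tfin
      proof eventually_elim
        case (elim x)
        have "ennreal (\<Sum>j = - int N..int N. norm (g j x)) \<le> T x"
          using sum_le_nn_integral_int[of "{- int N..int N}" "\<lambda>j. ennreal (norm (g j x))"]
          by (simp add: T_def)
        then have "(\<Sum>j = - int N..int N. norm (g j x)) \<le> enn2real (T x)"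
          using elim by (cases "T x") auto
        then have "norm (\<Sum>j = - int N..int N. g j x) \<le> enn2real (T x)"
          by (rule order_trans[OF norm_sum])
        then show ?case by (simp add: w_def norm_mult mult_right_mono)
      qed
    qed measurable
    show "integrable lebesgue (\<lambda>x. G x * f x)"
      by (rule integrable_dominated_convergence[OF dom(1,2) w dom(3,4)])
    have "(\<lambda>N. LINT x|lebesgue. (\<Sum>j = - int N..int N. g j x) * f x) \<longlonglongrightarrow> (LINT x|lebesgue. G x * f x)"
      by (rule integral_dominated_convergence[OF dom(1,2) w dom(3,4)])
    moreover have "(LINT x|lebesgue. (\<Sum>j = - int N..int N. g j x) * f x) = (\<Sum>j = - int N..int N. v j f)" for N
    proof -
      have "(LINT x|lebesgue. (\<Sum>j = - int N..int N. g j x) * f x) = (\<Sum>j = - int N..int N. LINT x|lebesgue. g j x * f x)"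
        unfolding sum_distrib_right
        by (rule Bochner_Integration.integral_sum) (rule represents_integrable[OF rep f])
      then show ?thesis by (simp only: represents_eq[OF rep f])
    qed
    ultimately show "u f = (LINT x|lebesgue. G x * f x)"
      using lim[OF f] LIMSEQ_unique by fastforce
  qed
  then show ?thesis using that GT unfolding T_def by blast
qed

lemma besov_inter_lorentz_bound:
  fixes \<phi> :: "real^'n \<Rightarrow> real" and \<alpha> \<beta> \<theta> p :: real and q\<^sub>0 q\<^sub>1 r\<^sub>0 r\<^sub>1 r :: ennreal
  assumes \<phi>: "lp_cutoff \<phi>"
    and pos: "\<alpha> > 0" "\<beta> > 0"
    and q: "q\<^sub>0 \<ge> 1" "q\<^sub>1 \<ge> 1" "q\<^sub>0 \<noteq> q\<^sub>1"
    and \<theta>: "\<theta> = \<alpha> / (\<alpha> + \<beta>)"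
    and p: "1 / p = (1 - \<theta>) * recip q\<^sub>0 + \<theta> * recip q\<^sub>1"
    and r: "r\<^sub>0 \<ge> 1" "r\<^sub>1 \<ge> 1" "r \<ge> 1"
    and rr: "recip r = (1 - \<theta>) * recip r\<^sub>0 + \<theta> * recip r\<^sub>1"
  shows "\<exists>C\<^sub>0::real. \<forall>f \<in> besov_inter \<phi> \<alpha> q\<^sub>0 r\<^sub>0 (- \<beta>) q\<^sub>1 r\<^sub>1.
           \<exists>g \<in> lorentz_space p r. represents g f \<and>
             lorentz_norm p r g \<le> ennreal C\<^sub>0 *
               besov_seminorm \<phi> \<alpha> q\<^sub>0 r\<^sub>0 f ^\<^sub>e (1 - \<theta>) *
               besov_seminorm \<phi> (- \<beta>) q\<^sub>1 r\<^sub>1 f ^\<^sub>e \<theta>"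
proof -
  define \<delta> where "\<delta> = recip q\<^sub>0 - recip q\<^sub>1"
  \<comment> \<open>With this choice \<open>\<alpha> * \<kappa> = 1/p - recip q\<^sub>0\<close> and
    \<open>- \<beta> * \<kappa> = 1/p - recip q\<^sub>1\<close>, so both terms of the minimum carry
    the right power of 2 powr k. It is nonzero because the two exponents differ.\<close>
  define \<kappa> where "\<kappa> = - \<delta> / (\<alpha> + \<beta>)"
  have \<delta>: "\<delta> \<noteq> 0" using recip_inject[OF q(1,2)] q(3) by (auto simp: \<delta>_def)
  have \<kappa>: "\<kappa> \<noteq> 0" using \<delta> pos by (simp add: \<kappa>_def)
  have \<theta>01: "0 < \<theta>" "\<theta> < 1" using pos by (auto simp: \<theta> field_simps)
  have \<alpha>\<kappa>: "\<alpha> * \<kappa> = - \<theta> * \<delta>" "- \<beta> * \<kappa> = (1 - \<theta>) * \<delta>" using pos by (auto simp: \<theta> \<kappa>_def field_simps)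
  have pq: "1 / p - recip q\<^sub>0 = - \<theta> * \<delta>" "1 / p - recip q\<^sub>1 = (1 - \<theta>) * \<delta>"
    unfolding p by (auto simp: \<delta>_def algebra_simps)
  \<comment> \<open>The two reciprocals are nonnegative and distinct, so one of them is positive,
    and both weights are positive.\<close>
  have "1 / p > 0"
  proof -
    have "recip q\<^sub>0 > 0 \<or> recip q\<^sub>1 > 0"
      using recip_bounds[OF q(1)] recip_bounds[OF q(2)] \<delta> by (auto simp: \<delta>_def)
    then show ?thesis
      unfolding p using recip_bounds[OF q(1)] recip_bounds[OF q(2)] \<theta>01
      by (auto intro: add_pos_nonneg add_nonneg_pos)
  qed
  then have p0: "p > 0" by simp
  obtain C where C: "C \<ge> 0" and disc: "\<And>a b N M. (\<forall>j. 0 \<le> a j) \<Longrightarrow> (\<forall>j. 0 \<le> b j) \<Longrightarrow> 0 \<le> N \<Longrightarrow> 0 \<le> M \<Longrightarrow>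
     seq_norm_le r\<^sub>0 a N \<Longrightarrow> seq_norm_le r\<^sub>1 b M \<Longrightarrow>
     (\<exists>h. (\<forall>k. 0 \<le> h k) \<and> seq_norm_le r h (C * N powr (1 - \<theta>) * M powr \<theta>) \<and>
       (\<forall>k F. finite F \<longrightarrow> (\<Sum>j\<in>F. min (2 powr (\<alpha> * (\<kappa> * of_int k - of_int j)) * a j)
                                  (2 powr (- \<beta> * (\<kappa> * of_int k - of_int j)) * b j)) \<le> h k))"
    using discrete_interpolation[OF pos \<kappa> \<theta> r rr] by blast
  define C\<^sub>0 where "C\<^sub>0 = 2 powr (1 / p) * 2 * C"
  show ?thesis
  proof (intro exI[of _ C\<^sub>0] ballI)
    fix u assume u: "u \<in> besov_inter \<phi> \<alpha> q\<^sub>0 r\<^sub>0 (- \<beta>) q\<^sub>1 r\<^sub>1"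
    define S0 where "S0 = besov_seminorm \<phi> \<alpha> q\<^sub>0 r\<^sub>0 u"
    define S1 where "S1 = besov_seminorm \<phi> (- \<beta>) q\<^sub>1 r\<^sub>1 u"
    define N M where "N = enn2real S0" and "M = enn2real S1"
    have fin: "S0 < \<infinity>" "S1 < \<infinity>" using u by (auto simp: besov_inter_def S0_def S1_def)
    then have S: "S0 = ennreal N" "S1 = ennreal M" "0 \<le> N" "0 \<le> M" by (auto simp: N_def M_def)
    let ?v = "\<lambda>j. lp_block \<phi> j u"
    define d0 where "d0 j = enn2real (dLq_norm q\<^sub>0 (?v j))" for j
    define d1 where "d1 j = enn2real (dLq_norm q\<^sub>1 (?v j))" for j
    note b0 = besov_seminorm_finite[OF fin(1)[unfolded S0_def] r(1), folded d0_def S0_def N_def]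
    note b1 = besov_seminorm_finite[OF fin(2)[unfolded S1_def] r(2), folded d1_def S1_def M_def]
    have d_nonneg: "0 \<le> d0 j" "0 \<le> d1 j" for j by (auto simp: d0_def d1_def)
    obtain g where g: "\<And>j. represents (g j) (?v j)"
      using dLq_norm_finite_imp_represents[OF b0(1)] by metis
    have gm: "g j \<in> borel_measurable lebesgue" for j using g by (rule represents_measurable)
    \<comment> \<open>By uniqueness one representing function of the block computes both
      norms.\<close>
    have norms: "Lq_norm q\<^sub>0 (g j) \<le> ennreal (d0 j)" "Lq_norm q\<^sub>1 (g j) \<le> ennreal (d1 j)" for j
      using dLq_norm_eq[OF \<phi> g] b0(1)[of j] b1(1)[of j] by (simp_all add: d0_def d1_def)
    obtain h where h: "\<And>k. 0 \<le> h k" "seq_norm_le r h (C * N powr (1 - \<theta>) * M powr \<theta>)"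
      and hsum: "\<And>k F. finite F \<Longrightarrow> (\<Sum>j\<in>F. min (2 powr (\<alpha> * (\<kappa> * of_int k - of_int j)) * (2 powr (of_int j * \<alpha>) * d0 j))
                                  (2 powr (- \<beta> * (\<kappa> * of_int k - of_int j)) * (2 powr (of_int j * - \<beta>) * d1 j))) \<le> h k"
      using disc[OF _ _ S(3,4) b0(2) b1(2)] d_nonneg by auto
    define c where "c k j = min (d0 j * (2 powr real_of_int k) powr (- recip q\<^sub>0))
        (d1 j * (2 powr real_of_int k) powr (- recip q\<^sub>1))" for k j :: int
    have c0: "0 \<le> c k j" for k j using d_nonneg by (simp add: c_def)
    have c_eq: "c k j = 2 powr (- real_of_int k / p) * min (2 powr (\<alpha> * (\<kappa> * of_int k - of_int j)) * (2 powr (of_int j * \<alpha>) * d0 j))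
                                  (2 powr (- \<beta> * (\<kappa> * of_int k - of_int j)) * (2 powr (of_int j * - \<beta>) * d1 j))" for k j
    proof -
      have e0: "2 powr (- real_of_int k / p) * (2 powr (\<alpha> * (\<kappa> * of_int k - of_int j)) * (2 powr (of_int j * \<alpha>) * d0 j))
          = d0 j * (2 powr real_of_int k) powr (- recip q\<^sub>0)"
      proof -
        have "- real_of_int k / p + (\<alpha> * (\<kappa> * of_int k - of_int j) + of_int j * \<alpha>)
            = real_of_int k * (\<alpha> * \<kappa> - 1 / p)" by (simp add: algebra_simps)
        also have "\<alpha> * \<kappa> - 1 / p = - recip q\<^sub>0" using \<alpha>\<kappa>(1) pq(1) by linarith
        finally have ex: "- real_of_int k / p + (\<alpha> * (\<kappa> * of_int k - of_int j) + of_int j * \<alpha>) = real_of_int k * (- recip q\<^sub>0)" .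
        show ?thesis unfolding powr_powr ex[symmetric] powr_add by (simp only: mult_ac)
      qed
      have e1: "2 powr (- real_of_int k / p) * (2 powr (- \<beta> * (\<kappa> * of_int k - of_int j)) * (2 powr (of_int j * - \<beta>) * d1 j))
          = d1 j * (2 powr real_of_int k) powr (- recip q\<^sub>1)"
      proof -
        have "- real_of_int k / p + (- \<beta> * (\<kappa> * of_int k - of_int j) + of_int j * - \<beta>)
            = real_of_int k * (- \<beta> * \<kappa> - 1 / p)" by (simp add: algebra_simps)
        also have "- \<beta> * \<kappa> - 1 / p = - recip q\<^sub>1" using \<alpha>\<kappa>(2) pq(2) by linarith
        finally have ex: "- real_of_int k / p + (- \<beta> * (\<kappa> * of_int k - of_int j) + of_int j * - \<beta>) = real_of_int k * (- recip q\<^sub>1)" .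
        show ?thesis unfolding powr_powr ex[symmetric] powr_add by (simp only: mult_ac)
      qed
      have mm: "t * min x y = min (t * x) (t * y)" if "t \<ge> 0" for t x y :: real
        using that by (simp add: min_mult_distrib_left)
      show ?thesis unfolding mm[OF powr_ge_zero] e0 e1 c_def ..
    qed
    have csum: "sum (c k) F \<le> h k * 2 powr (- real_of_int k / p)" if "finite F" for k F
      unfolding c_eq sum_distrib_left[symmetric]
      by (subst mult.commute) (intro mult_right_mono hsum that powr_ge_zero)
    have ex: "(\<integral>\<^sup>+x. ennreal (max 0 (norm (g j x) - c k j)) \<partial>lebesgue) \<le> ennreal (c k j * 2 powr real_of_int k)" for k j
    proof -
      define s where "s = 2 powr real_of_int k"
      have s: "s > 0" by (simp add: s_def)
      have sp: "s powr (1 - x) = s powr (- x) * s" for x using s powr_add[of s "- x" 1] by simp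
      \<comment> \<open>The minimum equals one of the two levels, and the excess bound holds at
        either.\<close>
      have "c k j = d0 j * s powr (- recip q\<^sub>0) \<or> c k j = d1 j * s powr (- recip q\<^sub>1)"
        by (auto simp: c_def s_def min_def)
      then show ?thesis
        using nn_integral_excess_le[OF gm q(1) norms(1) d_nonneg(1) s, of j]
          nn_integral_excess_le[OF gm q(2) norms(2) d_nonneg(2) s, of j]
        unfolding sp s_def[symmetric] by (auto simp: mult.assoc)
    qed
    \<comment> \<open>The double limit in \<open>besov_inter\<close> is restricted to the
      diagonal.\<close>
    have lim: "(\<lambda>N. \<Sum>j = - int N..int N. ?v j f) \<longlonglongrightarrow> u f" if f: "f \<in> schwartz_space" for f
    proof -
      have "((\<lambda>(M, N). \<Sum>j = - int M..int N. ?v j f) \<longlongrightarrow> u f) (sequentially \<times>\<^sub>F sequentially)"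
        using u f by (simp add: besov_inter_def)
      moreover have "filterlim (\<lambda>N::nat. (N, N)) (sequentially \<times>\<^sub>F sequentially) sequentially"
        by (intro filterlim_Pair filterlim_ident)
      ultimately show ?thesis by (auto dest: filterlim_compose)
    qed
    \<comment> \<open>G is built from the levels for k = 0, that is s = 1; the levels for general k
      then bound its rearrangement at 2 powr k.\<close>
    obtain G where G: "represents G u"
      "AE x in lebesgue. ennreal (norm (G x)) \<le> (\<integral>\<^sup>+j. ennreal (norm (g j x)) \<partial>count_space UNIV)"
    proof (rule represents_series[of g ?v "c 0" "h 0" u, OF g c0])
      show "sum (c 0) F \<le> h 0" if "finite F" for F using csum[OF that, of 0] by simp
      show "(\<integral>\<^sup>+x. ennreal (max 0 (norm (g j x) - c 0 j)) \<partial>lebesgue) \<le> ennreal (c 0 j)" for j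
        using ex[of j 0] by simp
    qed (use lim in blast)+
    have re: "rearrangement G (2 powr k) \<le> ennreal (2 * h k * 2 powr (- real_of_int k / p))" for k :: int
      using rearrangement_le[of g G "c k" "h k * 2 powr (- real_of_int k / p)" "2 powr real_of_int k",
          OF gm represents_measurable[OF G(1)] c0 csum _ ex G(2)]
      by (simp add: mult.assoc)
    have "lorentz_norm p r G \<le> ennreal (2 powr (1 / p) * 2 * (C * N powr (1 - \<theta>) * M powr \<theta>))"
      using C by (intro lorentz_norm_le_dyadic[OF p0 r(3) h _ re]) auto
    also have "\<dots> = ennreal C\<^sub>0 * S0 ^\<^sub>e (1 - \<theta>) * S1 ^\<^sub>e \<theta>"
      using C S(3,4) by (simp add: S(1,2) epow_ennreal C\<^sub>0_def mult.assoc flip: ennreal_mult)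
    finally have le: "lorentz_norm p r G \<le> ennreal C\<^sub>0 * S0 ^\<^sub>e (1 - \<theta>) * S1 ^\<^sub>e \<theta>" .
    moreover have "\<dots> < \<infinity>"
      using S(3,4) by (simp add: S(1,2) epow_ennreal ennreal_mult_less_top)
    ultimately have "lorentz_norm p r G < \<infinity>" by (rule order_le_less_trans)
    moreover have "G \<in> borel_measurable lebesgue" using G(1) by (rule represents_measurable)
    ultimately show "\<exists>g \<in> lorentz_space p r. represents g u \<and>
             lorentz_norm p r g \<le> ennreal C\<^sub>0 *
               besov_seminorm \<phi> \<alpha> q\<^sub>0 r\<^sub>0 u ^\<^sub>e (1 - \<theta>) *
               besov_seminorm \<phi> (- \<beta>) q\<^sub>1 r\<^sub>1 u ^\<^sub>e \<theta>"
      using G(1) le unfolding S0_def S1_def lorentz_space_def by blast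
  qed
qed

theorem theorem5:
  fixes \<phi> :: "real^'n \<Rightarrow> real"
    and \<alpha> \<beta> \<theta> p x\<^sub>0 y\<^sub>0 x\<^sub>1 y\<^sub>1 :: real
    and q\<^sub>0 q\<^sub>1 r\<^sub>0 r\<^sub>1 r :: ennreal
  assumes "lp_cutoff \<phi>"
    and "\<alpha> > 0" and "\<beta> > 0"
    and "q\<^sub>0 \<ge> 1" and "q\<^sub>1 \<ge> 1" and "q\<^sub>0 \<noteq> q\<^sub>1"
    and "\<theta> = \<alpha> / (\<alpha> + \<beta>)"
    and "1 / p = (1 - \<theta>) * recip q\<^sub>0 + \<theta> * recip q\<^sub>1"
    and "p \<le> 2"
    and "{(x, y). 0 \<le> x \<and> x \<le> 1 \<and> 0 \<le> y \<and> y \<le> 1 \<and> (1 - \<theta>) * x + \<theta> * y = 1 / p}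
           = closed_segment (x\<^sub>0, y\<^sub>0) (x\<^sub>1, y\<^sub>1)"
    and "x\<^sub>0 < y\<^sub>0" and "y\<^sub>1 < x\<^sub>1"
    and "r\<^sub>0 \<ge> 1" and "r\<^sub>1 \<ge> 1" and "r \<ge> 1"
    and "x\<^sub>0 \<le> recip r\<^sub>0 \<and> recip r\<^sub>0 \<le> recip r\<^sub>1 \<and> recip r\<^sub>1 \<le> y\<^sub>0 \<or>
         y\<^sub>1 \<le> recip r\<^sub>1 \<and> recip r\<^sub>1 \<le> recip r\<^sub>0 \<and> recip r\<^sub>0 \<le> x\<^sub>1"
    and "recip r = (1 - \<theta>) * recip r\<^sub>0 + \<theta> * recip r\<^sub>1"
  shows "\<exists>C\<^sub>0::real. \<forall>f \<in> besov_inter \<phi> \<alpha> q\<^sub>0 r\<^sub>0 (- \<beta>) q\<^sub>1 r\<^sub>1.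
           \<exists>g \<in> lorentz_space p r. represents g f \<and>
             lorentz_norm p r g \<le> ennreal C\<^sub>0 *
               besov_seminorm \<phi> \<alpha> q\<^sub>0 r\<^sub>0 f ^\<^sub>e (1 - \<theta>) *
               besov_seminorm \<phi> (- \<beta>) q\<^sub>1 r\<^sub>1 f ^\<^sub>e \<theta>"
  by (rule besov_inter_lorentz_bound) (fact assms)+

end
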